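(* Let $n\ge2$ and let $D\subsetneq\mathbb{R}^n$ be an Apollonian proper subdomain. The following conditions are quantitatively equivalent: (1) $D$ is $A$-uniform with coefficient $K$, i.e. $k_D(x,y)\le K\alpha_D(x,y)$ for all $x,y\in D$; (2) $D$ is inner $c$-uniform and there is a constant $\mu_5$ such that $j'_D(x,y)\le\mu_5\,\alpha_D(x,y)$ for all $x,y\in D$. Here the constants depend only on each other and $n$: if (1) holds with $K$ then (2) holds with $c,\mu_5$ depending only on $K$ and $n$, and if (2) holds with $c,\mu_5$ then (1) holds with $K$ depending only on $c,\mu_5$ and $n$.
   Context: $D$ is a proper subdomain (open connected proper nonempty subset) of $\mathbb{R}^n$, $n\ge2$; $d_D(z)$ is the Euclidean distance from $z\in D$ to $\partial D$; $\operatorname{diam}$ is Euclidean diameter; $\ell$ is Euclidean arc length. For an arc $\gamma$ and points $z,w$ on it, $\gamma[z,w]$ is the part of $\gamma$ between $z$ and $w$. All paths are assumed rectifiable. Apollonian distance: $\alpha_D(x,y)=\sup_{a,b\in\partial D}\log\frac{|a-x||b-y|}{|a-y||b-x|}$, where the boundary is taken in $\mathbb{R}^n\cup\{\infty\}$ (so $\infty\in\partial D$ when $D$ is unbounded) with the convention $\frac{|\infty-x|}{|\infty-y|}=1$. $D$ is called Apollonian if $\mathbb{R}^n\setminus D$ is not contained in a hyperplane (equivalently, $\alpha_D$ is a metric). $\lambda_D(x,y)=\inf_\gamma\ell(\gamma)$ over paths $\gamma$ in $D$ joining $x,y$; $\varrho_D(x,y)=\inf_\gamma\operatorname{diam}(\gamma)$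 over all arcs $\gamma$ joining $x$ and $y$ in $D$; $j'_D(x,y)=\log\Big(1+\frac{\varrho_D(x,y)}{\min\{d_D(x),d_D(y)\}}\Big)$; and the quasihyperbolic metric is $k_D(x,y)=\inf_\gamma\int_\gamma\frac{|dz|}{d_D(z)}$ over paths $\gamma$ joining $x,y$ in $D$. $D$ is inner $c$-uniform if each pair $z_1,z_2\in D$ can be joined by a rectifiable arc $\gamma$ in $D$ with $\min\{\ell(\gamma[z_1,z]),\ell(\gamma[z_2,z])\}\le c\,d_D(z)$ for all $z\in\gamma$, and $\ell(\gamma)\le c\,\lambda_D(z_1,z_2)$. *)

theory Defs
  imports "HOL-Analysis.Analysis"
begin

definition proper_subdomain :: "'a::euclidean_space set \<Rightarrow> bool" where
  "proper_subdomain D \<longleftrightarrow> open D \<and> connected D \<and> D \<noteq> {} \<and> D \<noteq> UNIV"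

definition apollonian :: "'a::euclidean_space set \<Rightarrow> bool" where
  "apollonian D \<longleftrightarrow> \<not> (\<exists>a b. a \<noteq> 0 \<and> - D \<subseteq> {x. a \<bullet> x = b})"

definition bdist :: "'a::euclidean_space set \<Rightarrow> 'a \<Rightarrow> real" where
  "bdist D z = infdist z (frontier D)"


subsection \<open>Rectifiable paths and arc length\<close>

definition variation_sums :: "(real \<Rightarrow> 'a::metric_space) \<Rightarrow> real set" where
  "variation_sums g =
     {\<Sum>i<n. dist (g (t i)) (g (t (Suc i))) | n t. mono t \<and> (\<forall>i::nat. t i \<in> {0..1})}"

definition rectifiable :: "(real \<Rightarrow> 'a::metric_space) \<Rightarrow> bool" where
  "rectifiable g \<longleftrightarrow> path g \<and> bdd_above (variation_sums g)"

text \<open>Only meaningful for rectifiable paths.\<close>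

definition path_length :: "(real \<Rightarrow> 'a::metric_space) \<Rightarrow> real" where
  "path_length g = Sup (variation_sums g)"

text \<open>
  The point of \<^term>\<open>g\<close> at arc length \<^term>\<open>u\<close> from the start, for \<^term>\<open>u\<close> between
  \<^term>\<open>0\<close> and \<^term>\<open>path_length g\<close>. The parameter chosen is irrelevant, because \<^term>\<open>g\<close> is
  constant wherever the arc length does not increase.
\<close>

definition arclength_param :: "(real \<Rightarrow> 'a::real_normed_vector) \<Rightarrow> real \<Rightarrow> 'a" where
  "arclength_param g u = g (SOME t. t \<in> {0..1} \<and> path_length (subpath 0 t g) = u)"

definition arclength_integral :: "('a::real_normed_vector \<Rightarrow> real) \<Rightarrow> (real \<Rightarrow> 'a) \<Rightarrow> real" where
  "arclength_integral f g = integral {0..path_length g} (\<lambda>u. f (arclength_param g u))"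

definition rect_paths :: "'a::euclidean_space set \<Rightarrow> 'a \<Rightarrow> 'a \<Rightarrow> (real \<Rightarrow> 'a) set" where
  "rect_paths D x y =
     {g. rectifiable g \<and> path_image g \<subseteq> D \<and> pathstart g = x \<and> pathfinish g = y}"

text \<open>For coinciding end points, the arcs are the degenerate (constant) ones.\<close>

definition rect_arcs :: "'a::euclidean_space set \<Rightarrow> 'a \<Rightarrow> 'a \<Rightarrow> (real \<Rightarrow> 'a) set" where
  "rect_arcs D x y = {g \<in> rect_paths D x y. arc g \<or> path_image g = {x}}"


subsection \<open>Distance functions on a domain\<close>

text \<open>
  Points of the one-point compactification: \<^term>\<open>None\<close> is the point at infinity.
\<close>

definition ext_frontier :: "'a::euclidean_space set \<Rightarrow> 'a option set" where
  "ext_frontier D = Some ` frontier D \<union> (if bounded D then {} else {None})"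

fun dist_ratio :: "'a::euclidean_space option \<Rightarrow> 'a \<Rightarrow> 'a \<Rightarrow> real" where
  "dist_ratio (Some a) x y = dist a x / dist a y"
| "dist_ratio None x y = 1"

definition apollonian_dist :: "'a::euclidean_space set \<Rightarrow> 'a \<Rightarrow> 'a \<Rightarrow> real" where
  "apollonian_dist D x y =
     (SUP (a, b) \<in> ext_frontier D \<times> ext_frontier D. ln (dist_ratio a x y * dist_ratio b y x))"

definition inner_length_dist :: "'a::euclidean_space set \<Rightarrow> 'a \<Rightarrow> 'a \<Rightarrow> real" where
  "inner_length_dist D x y = (INF g \<in> rect_paths D x y. path_length g)"

definition inner_diam_dist :: "'a::euclidean_space set \<Rightarrow> 'a \<Rightarrow> 'a \<Rightarrow> real" where
  "inner_diam_dist D x y = (INF g \<in> rect_arcs D x y. diameter (path_image g))"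

definition j'_dist :: "'a::euclidean_space set \<Rightarrow> 'a \<Rightarrow> 'a \<Rightarrow> real" where
  "j'_dist D x y = ln (1 + inner_diam_dist D x y / min (bdist D x) (bdist D y))"

definition quasihyperbolic_dist :: "'a::euclidean_space set \<Rightarrow> 'a \<Rightarrow> 'a \<Rightarrow> real" where
  "quasihyperbolic_dist D x y =
     (INF g \<in> rect_paths D x y. arclength_integral (\<lambda>z. 1 / bdist D z) g)"


subsection \<open>Uniformity conditions\<close>

definition A_uniform :: "real \<Rightarrow> 'a::euclidean_space set \<Rightarrow> bool" where
  "A_uniform K D \<longleftrightarrow>
     (\<forall>x\<in>D. \<forall>y\<in>D. quasihyperbolic_dist D x y \<le> K * apollonian_dist D x y)"

definition inner_uniform :: "real \<Rightarrow> 'a::euclidean_space set \<Rightarrow> bool" where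
  "inner_uniform c D \<longleftrightarrow>
     (\<forall>z1\<in>D. \<forall>z2\<in>D. \<exists>g \<in> rect_arcs D z1 z2.
        (\<forall>t\<in>{0..1}. min (path_length (subpath 0 t g)) (path_length (subpath t 1 g))
                      \<le> c * bdist D (g t)) \<and>
        path_length g \<le> c * inner_length_dist D z1 z2)"

end

(*
From (1) to (2): since alpha_D is at most twice the distance ratio metric
j_D(x,y) = ln (1 + |x-y| / min {d(x), d(y)}), A-uniformity gives k_D <= C j_D, and the
Gehring-Osgood argument shows that nearly k_D-minimal connections have the cigar property
and length at most c |x-y|. The argument is run on finite chains of points whose weight
|x_i - x_{i+1}| / min {d(x_i), d(x_{i+1})} replaces the quasihyperbolic length; the polygon
through a chain becomes an arc by erasing its loops. The inequality j'_D <= k_D always holds.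

From (2) to (1): integrating 1/d_D along an inner uniform arc gives
k_D <= C ln (1 + lambda_D / min d_D), and in an inner uniform domain of R^n one has
lambda_D <= C(n,c) rho_D by a covering argument, so that k_D <= C' j'_D <= C' mu_5 alpha_D.
*)
theory Submission
  imports Defs
begin

section \<open>Arc length\<close>

text \<open>Finite chains need no quasihyperbolic geodesics: the infimum of the weights is
  approached within 1, and the same excess bounds every subchain. The price is an additive constant
  in the estimate of the weight by C ln (1 + |x-y| / min d) + 2, which is worthless for points that
  are close compared with their depth in D; such pairs are joined by a segment instead. For all
  other pairs the constant can be absorbed.

  In the converse direction the obstacle is that rho_D is a diameter, and a path of small diameter
  can be arbitrarily long. The path itself is therefore never followed: inner uniformity leads from
  each of its points, within bounded length, to a point whose depth is comparable to the diameter,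
  and nearby deep points see each other along a segment. The number of small balls needed to cover
  the region of deep points is the only place where n enters.\<close>

definition var_set :: "(real \<Rightarrow> 'a::metric_space) \<Rightarrow> real \<Rightarrow> real \<Rightarrow> real set" where
  "var_set g a b =
     {\<Sum>i<n. dist (g (t i)) (g (t (Suc i))) | n t. mono t \<and> (\<forall>i::nat. t i \<in> {a..b})}"

text \<open>Keeping the parameter interval explicit lets the pieces of one path be compared without
  reparametrised subpaths. As a real supremum it is meaningful only where \<open>var_set\<close> is
  bounded above.\<close>

definition vlen :: "(real \<Rightarrow> 'a::metric_space) \<Rightarrow> real \<Rightarrow> real \<Rightarrow> real" where
  "vlen g a b = Sup (var_set g a b)"

lemma variation_sums_eq: "variation_sums g = var_set g 0 1"
  by (simp add: variation_sums_def var_set_def)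

lemma path_length_eq: "path_length g = vlen g 0 1"
  by (simp add: path_length_def vlen_def variation_sums_eq)

lemma variation_sums_subpath:
  assumes "a \<le> b" shows "variation_sums (subpath a b g) = var_set g a b"
proof (intro equalityI subsetI)
  fix s assume "s \<in> variation_sums (subpath a b g)"
  then obtain n t where t: "mono t" "\<forall>i::nat. t i \<in> {0..1}"
    and s: "s = (\<Sum>i<n. dist (subpath a b g (t i)) (subpath a b g (t (Suc i))))"
    by (auto simp: variation_sums_def)
  have "mono (\<lambda>i. (b - a) * t i + a)"
    using t assms by (auto simp: mono_def intro!: mult_left_mono)
  moreover have "(b - a) * t i + a \<in> {a..b}" for i
    using t(2) assms mult_left_mono[of "t i" 1 "b - a"] by auto
  ultimately show "s \<in> var_set g a b"
    unfolding var_set_def s subpath_def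
    by (intro CollectI exI[of _ n] exI[of _ "\<lambda>i. (b - a) * t i + a"]) auto
next
  fix s assume "s \<in> var_set g a b"
  then obtain n t where t: "mono t" "\<forall>i::nat. t i \<in> {a..b}"
    and s: "s = (\<Sum>i<n. dist (g (t i)) (g (t (Suc i))))"
    by (auto simp: var_set_def)
  define u where "u i = (t i - a) / (b - a)" for i
  have "mono u"
    using t assms by (auto simp: mono_def u_def intro!: divide_right_mono)
  moreover have "u i \<in> {0..1}" for i
    using t(2)[rule_format, of i] assms by (auto simp: u_def divide_simps)
  moreover have "subpath a b g (u i) = g (t i)" for i
  \<comment> \<open>For \<open>a = b\<close> division by zero gives \<open>u i = 0\<close>, which is
    still a legal partition point of a constant path.\<close>
  proof (cases "a = b")
    case True
    then have "t i = a" using t(2)[rule_format, of i] by auto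
    then show ?thesis using True by (simp add: subpath_def)
  qed (simp add: subpath_def u_def)
  ultimately show "s \<in> variation_sums (subpath a b g)"
    unfolding variation_sums_def s
    by (intro CollectI exI[of _ n] exI[of _ u]) auto
qed

lemma path_length_subpath: "a \<le> b \<Longrightarrow> path_length (subpath a b g) = vlen g a b"
  by (simp add: path_length_def vlen_def variation_sums_subpath)

lemma var_set_mono: "a \<le> a' \<Longrightarrow> b' \<le> b \<Longrightarrow> var_set g a' b' \<subseteq> var_set g a b"
  using atLeastatMost_subset_iff[of a' b' a b] unfolding var_set_def by blast

lemma zero_in_var_set: "a \<le> b \<Longrightarrow> 0 \<in> var_set g a b"
  unfolding var_set_def
  by (intro CollectI exI[of _ "0::nat"] exI[of _ "\<lambda>_. a"]) (auto simp: mono_def)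

lemma dist_in_var_set: "a \<le> b \<Longrightarrow> dist (g a) (g b) \<in> var_set g a b"
  unfolding var_set_def
  by (intro CollectI exI[of _ "1::nat"] exI[of _ "\<lambda>i. if i = 0 then a else b"]) (auto simp: mono_def)

text \<open>If the increments of \<open>\<Lambda>\<close> dominate distances, every variation sum
  telescopes. Upper bounds for lengths of concrete paths are obtained below by exhibiting such a
  \<open>\<Lambda>\<close>.\<close>

lemma var_set_bound:
  assumes "\<And>u v. a \<le> u \<Longrightarrow> u \<le> v \<Longrightarrow> v \<le> b \<Longrightarrow> dist (g u) (g v) \<le> \<Lambda> v - \<Lambda> u"
    and "s \<in> var_set g a b"
  shows "s \<le> \<Lambda> b - \<Lambda> a"
proof -
  obtain n t where t: "mono t" "\<And>i::nat. t i \<in> {a..b}"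
    and s: "s = (\<Sum>i<n. dist (g (t i)) (g (t (Suc i))))"
    using assms(2) by (auto simp: var_set_def)
  have "s \<le> (\<Sum>i<n. \<Lambda> (t (Suc i)) - \<Lambda> (t i))"
    unfolding s using t by (intro sum_mono assms(1)) (auto simp: mono_def)
  also have "\<dots> = \<Lambda> (t n) - \<Lambda> (t 0)"
    by (rule sum_lessThan_telescope)
  also have "\<dots> \<le> \<Lambda> b - \<Lambda> a"
  proof -
    have "0 \<le> \<Lambda> b - \<Lambda> (t n)" "0 \<le> \<Lambda> (t 0) - \<Lambda> a"
      using assms(1)[of "t n" b] assms(1)[of a "t 0"] t(2)[of n] t(2)[of 0]
      by (smt (verit) atLeastAtMost_iff zero_le_dist)+
    then show ?thesis by simp
  qed
  finally show ?thesis .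
qed

lemma vlen_bound:
  assumes "\<And>u v. a \<le> u \<Longrightarrow> u \<le> v \<Longrightarrow> v \<le> b \<Longrightarrow> dist (g u) (g v) \<le> \<Lambda> v - \<Lambda> u" and "a \<le> b"
  shows "vlen g a b \<le> \<Lambda> b - \<Lambda> a"
  unfolding vlen_def
proof (rule cSup_least)
  show "var_set g a b \<noteq> {}" using zero_in_var_set[OF assms(2)] by blast
qed (rule var_set_bound[OF assms(1)])

lemma bdd_above_var_set:
  assumes "\<And>u v. a \<le> u \<Longrightarrow> u \<le> v \<Longrightarrow> v \<le> b \<Longrightarrow> dist (g u) (g v) \<le> \<Lambda> v - \<Lambda> u"
  shows "bdd_above (var_set g a b)"
  by (rule bdd_aboveI) (rule var_set_bound[OF assms])

lemma rectifiableI: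
  assumes "path g" and "\<And>u v. 0 \<le> u \<Longrightarrow> u \<le> v \<Longrightarrow> v \<le> 1 \<Longrightarrow> dist (g u) (g v) \<le> \<Lambda> v - \<Lambda> u"
  shows "rectifiable g"
  using assms(1) bdd_above_var_set[of 0 1 g, OF assms(2)]
  by (simp add: rectifiable_def variation_sums_eq)

context
  fixes g :: "real \<Rightarrow> 'a::metric_space"
  assumes rect: "rectifiable g"
begin

lemma bdd_var_set: "0 \<le> a \<Longrightarrow> b \<le> 1 \<Longrightarrow> bdd_above (var_set g a b)"
  using rect bdd_above_mono[OF _ var_set_mono[of 0 a b 1 g]]
  by (simp add: rectifiable_def variation_sums_eq)

lemma le_vlen: "0 \<le> a \<Longrightarrow> b \<le> 1 \<Longrightarrow> s \<in> var_set g a b \<Longrightarrow> s \<le> vlen g a b"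
  unfolding vlen_def by (rule cSup_upper) (auto intro: bdd_var_set)

lemma dist_le_vlen: "0 \<le> a \<Longrightarrow> a \<le> b \<Longrightarrow> b \<le> 1 \<Longrightarrow> dist (g a) (g b) \<le> vlen g a b"
  by (intro le_vlen dist_in_var_set)

lemma vlen_nonneg: "0 \<le> a \<Longrightarrow> a \<le> b \<Longrightarrow> b \<le> 1 \<Longrightarrow> 0 \<le> vlen g a b"
  by (intro le_vlen zero_in_var_set)

lemma vlen_subadditive:
  assumes "0 \<le> a" "a \<le> b" "b \<le> c" "c \<le> 1"
  shows "vlen g a c \<le> vlen g a b + vlen g b c"
  unfolding vlen_def[of g a c]
proof (rule cSup_least)
  show "var_set g a c \<noteq> {}" using zero_in_var_set[of a c g] assms by auto
next
  fix s assume "s \<in> var_set g a c"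
  then obtain n t where t: "mono t" "\<And>i::nat. t i \<in> {a..c}"
    and s: "s = (\<Sum>i<n. dist (g (t i)) (g (t (Suc i))))"
    by (auto simp: var_set_def)
  \<comment> \<open>Clamping the partition points by \<open>min\<close> and \<open>max\<close> at
    \<open>b\<close> gives partitions of the two pieces; an edge that straddles \<open>b\<close> is
    split by the triangle inequality.\<close>
  have "s \<le> (\<Sum>i<n. dist (g (min (t i) b)) (g (min (t (Suc i)) b)))
          + (\<Sum>i<n. dist (g (max (t i) b)) (g (max (t (Suc i)) b)))"
    unfolding s sum.distrib[symmetric]
  proof (rule sum_mono)
    fix i
    have "t i \<le> t (Suc i)" using t by (auto simp: mono_def)
    then show "dist (g (t i)) (g (t (Suc i))) \<le> dist (g (min (t i) b)) (g (min (t (Suc i)) b))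
        + dist (g (max (t i) b)) (g (max (t (Suc i)) b))"
      using dist_triangle[of "g (t i)" "g (t (Suc i))" "g b"]
      by (auto simp: min_def max_def)
  qed
  also have "\<dots> \<le> vlen g a b + vlen g b c"
  proof (rule add_mono)
    show "(\<Sum>i<n. dist (g (min (t i) b)) (g (min (t (Suc i)) b))) \<le> vlen g a b"
      using assms t unfolding var_set_def
      by (intro le_vlen[unfolded var_set_def] CollectI exI[of _ n] exI[of _ "\<lambda>i. min (t i) b"])
        (auto simp: mono_def min.coboundedI1)
    show "(\<Sum>i<n. dist (g (max (t i) b)) (g (max (t (Suc i)) b))) \<le> vlen g b c"
      using assms t unfolding var_set_def
      by (intro le_vlen[unfolded var_set_def] CollectI exI[of _ n] exI[of _ "\<lambda>i. max (t i) b"])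
        (auto simp: mono_def max.coboundedI1)
  qed
  finally show "s \<le> vlen g a b + vlen g b c" .
qed

lemma vlen_superadditive:
  assumes "0 \<le> a" "a \<le> b" "b \<le> c" "c \<le> 1"
  shows "vlen g a b + vlen g b c \<le> vlen g a c"
proof -
  have *: "s + s' \<le> vlen g a c" if ss: "s \<in> var_set g a b" "s' \<in> var_set g b c" for s s'
  proof -
    obtain n t where t: "mono t" "\<And>i::nat. t i \<in> {a..b}"
      and s: "s = (\<Sum>i<n. dist (g (t i)) (g (t (Suc i))))"
      using ss(1) unfolding var_set_def by blast
    obtain m r where r: "mono r" "\<And>i::nat. r i \<in> {b..c}"
      and s': "s' = (\<Sum>i<m. dist (g (r i)) (g (r (Suc i))))"
      using ss(2) unfolding var_set_def by blast
    \<comment> \<open>The partitions are concatenated: \<open>n\<close> is the last index of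
      \<open>t\<close>, and \<open>Suc n\<close> carries \<open>r 0\<close>. The connecting edge
      only adds a nonnegative term, which is why \<open>Suc m\<close> further edges are
      summed.\<close>
    define q where "q i = (if i \<le> n then t i else r (i - Suc n))" for i
    have "mono q"
    proof (rule monoI)
      fix i j :: nat assume "i \<le> j"
      then show "q i \<le> q j"
        using t(1) r(1) t(2)[of i] r(2)[of "j - Suc n"]
        by (auto simp: q_def mono_def)
    qed
    moreover have "q i \<in> {a..c}" for i
      using t(2)[of i] r(2)[of "i - Suc n"] assms by (auto simp: q_def)
    ultimately have "(\<Sum>i<n + Suc m. dist (g (q i)) (g (q (Suc i)))) \<in> var_set g a c"
      unfolding var_set_def by blast
    then have "(\<Sum>i<n + Suc m. dist (g (q i)) (g (q (Suc i)))) \<le> vlen g a c"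
      using assms by (intro le_vlen) auto
    moreover have "(\<Sum>i<n + Suc m. dist (g (q i)) (g (q (Suc i))))
        = (\<Sum>i<n. dist (g (q i)) (g (q (Suc i)))) + (\<Sum>i<Suc m. dist (g (q (n + i))) (g (q (Suc (n + i)))))"
      by (induction m) (simp_all add: add.assoc)
    moreover have "(\<Sum>i<n. dist (g (q i)) (g (q (Suc i)))) = s"
      unfolding s by (rule sum.cong) (auto simp: q_def)
    moreover have "(\<Sum>i<Suc m. dist (g (q (n + i))) (g (q (Suc (n + i))))) \<ge> s'"
      unfolding s' sum.lessThan_Suc_shift by (simp add: q_def)
    ultimately show ?thesis by simp
  qed
  have "vlen g a b \<le> vlen g a c - vlen g b c"
    unfolding vlen_def[of g a b]
  proof (rule cSup_least)
    show "var_set g a b \<noteq> {}" using zero_in_var_set[of a b g] assms by auto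
    fix s assume s: "s \<in> var_set g a b"
    have "vlen g b c \<le> vlen g a c - s"
      unfolding vlen_def[of g b c]
    proof (rule cSup_least)
      show "var_set g b c \<noteq> {}" using zero_in_var_set[of b c g] assms by auto
    qed (use *[OF s] in \<open>simp add: algebra_simps\<close>)
    then show "s \<le> vlen g a c - vlen g b c" by simp
  qed
  then show ?thesis by simp
qed

lemma vlen_additive:
  assumes "0 \<le> a" "a \<le> b" "b \<le> c" "c \<le> 1"
  shows "vlen g a c = vlen g a b + vlen g b c"
  using vlen_subadditive[OF assms] vlen_superadditive[OF assms] by simp

lemma dist_le_vlen_diff:
  assumes "0 \<le> u" "u \<le> v" "v \<le> 1"
  shows "dist (g u) (g v) \<le> vlen g 0 v - vlen g 0 u"
  using vlen_additive[of 0 u v] dist_le_vlen[of u v] assms by simp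

text \<open>A partition that nearly realises the total length can be cut at \<^term>\<open>u\<close> and \<^term>\<open>v\<close>;
  by uniform continuity the part inside the short interval contributes little.\<close>

lemma continuous_vlen: "continuous_on {0..1} (vlen g 0)"
proof (rule uniformly_continuous_imp_continuous, unfold uniformly_continuous_on_def, intro allI impI)
  fix e :: real assume e: "e > 0"
  obtain s where s: "s \<in> var_set g 0 1" "vlen g 0 1 - e / 3 < s"
    using less_cSupE[of "vlen g 0 1 - e / 3" "var_set g 0 1"] zero_in_var_set[of 0 1 g] e
    unfolding vlen_def by force
  then obtain n t where t: "mono t" "\<And>i::nat. t i \<in> {0..1}"
    and s_eq: "s = (\<Sum>i<n. dist (g (t i)) (g (t (Suc i))))"
    by (auto simp: var_set_def)
  have "uniformly_continuous_on {0..1} g"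
    using rect by (intro compact_uniformly_continuous) (auto simp: rectifiable_def path_def)
  then obtain d where d: "d > 0"
    "\<And>x y. x \<in> {0..1} \<Longrightarrow> y \<in> {0..1} \<Longrightarrow> dist y x < d \<Longrightarrow> dist (g y) (g x) < e / (3 * real (Suc n))"
    unfolding uniformly_continuous_on_def using e by (metis divide_pos_pos mult_pos_pos of_nat_0_less_iff zero_less_Suc zero_less_numeral)
  have *: "vlen g 0 v - vlen g 0 u < e" if uv: "0 \<le> u" "u < v" "v \<le> 1" "v - u < d" for u v
  proof -
    define c where "c x = max u (min v x)" for x
    have "s \<le> (\<Sum>i<n. dist (g (min (t i) u)) (g (min (t (Suc i)) u)))
          + (\<Sum>i<n. dist (g (c (t i))) (g (c (t (Suc i)))))
          + (\<Sum>i<n. dist (g (max (t i) v)) (g (max (t (Suc i)) v)))"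
      unfolding s_eq sum.distrib[symmetric]
    proof (rule sum_mono)
      fix i
      have "t i \<le> t (Suc i)" using t by (auto simp: mono_def)
      then show "dist (g (t i)) (g (t (Suc i))) \<le> dist (g (min (t i) u)) (g (min (t (Suc i)) u))
          + dist (g (c (t i))) (g (c (t (Suc i)))) + dist (g (max (t i) v)) (g (max (t (Suc i)) v))"
        using dist_triangle[of "g (t i)" "g (t (Suc i))" "g u"]
          dist_triangle[of "g u" "g (t (Suc i))" "g v"]
          dist_triangle[of "g (t i)" "g (t (Suc i))" "g v"] uv
        by (cases "t i \<le> u"; cases "t (Suc i) \<le> u"; cases "t i \<le> v"; cases "t (Suc i) \<le> v")
          (auto simp: c_def min_def max_def)
    qed
    also have "\<dots> \<le> vlen g 0 u + e / 3 + vlen g v 1"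
    proof (intro add_mono)
      show "(\<Sum>i<n. dist (g (min (t i) u)) (g (min (t (Suc i)) u))) \<le> vlen g 0 u"
        using uv t
        by (intro le_vlen[unfolded var_set_def] CollectI exI[of _ n] exI[of _ "\<lambda>i. min (t i) u"])
          (auto simp: mono_def min.coboundedI1)
      show "(\<Sum>i<n. dist (g (max (t i) v)) (g (max (t (Suc i)) v))) \<le> vlen g v 1"
        using uv t
        by (intro le_vlen[unfolded var_set_def] CollectI exI[of _ n] exI[of _ "\<lambda>i. max (t i) v"])
          (auto simp: mono_def max.coboundedI1)
      have "(\<Sum>i<n. dist (g (c (t i))) (g (c (t (Suc i))))) \<le> (\<Sum>i<n. e / (3 * real (Suc n)))"
      proof (rule sum_mono)
        fix i
        have "dist (c (t i)) (c (t (Suc i))) < d"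
          using uv by (auto simp: c_def dist_real_def abs_if min_def max_def)
        then show "dist (g (c (t i))) (g (c (t (Suc i)))) \<le> e / (3 * real (Suc n))"
          using uv d(2)[of "c (t (Suc i))" "c (t i)"]
          by (simp add: c_def min.coboundedI1 le_max_iff_disj)
      qed
      also have "\<dots> \<le> e / 3" using e by (simp add: field_simps)
      finally show "(\<Sum>i<n. dist (g (c (t i))) (g (c (t (Suc i))))) \<le> e / 3" .
    qed
    finally show ?thesis
      using s(2) vlen_additive[of 0 v 1] uv e by simp
  qed
  show "\<exists>d>0. \<forall>x\<in>{0..1}. \<forall>x'\<in>{0..1}. dist x' x < d \<longrightarrow> dist (vlen g 0 x') (vlen g 0 x) < e"
  proof (intro exI[of _ d] conjI ballI impI)
    fix x y :: real assume xy: "x \<in> {0..1}" "y \<in> {0..1}" "dist y x < d"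
    show "dist (vlen g 0 y) (vlen g 0 x) < e"
    proof (cases x y rule: linorder_cases)
      case less
      then show ?thesis using *[of x y] xy order_trans[OF zero_le_dist dist_le_vlen_diff[of x y]]
        by (auto simp: dist_real_def)
    next
      case greater
      then show ?thesis using *[of y x] xy order_trans[OF zero_le_dist dist_le_vlen_diff[of y x]]
        by (auto simp: dist_real_def)
    qed (use e in simp)
  qed (use d in auto)
qed

lemma vlen_0_0: "vlen g 0 0 = 0"
  using vlen_additive[of 0 0 0] by simp

lemma vlen_surj: "0 \<le> u \<Longrightarrow> u \<le> path_length g \<Longrightarrow> \<exists>t\<in>{0..1}. vlen g 0 t = u"
  using IVT'[of "vlen g 0" 0 u 1] continuous_vlen by (auto simp: path_length_eq vlen_0_0)

lemma path_length_nonneg: "0 \<le> path_length g"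
  by (simp add: path_length_eq vlen_nonneg)

lemma dist_le_path_length: "dist (pathstart g) (pathfinish g) \<le> path_length g"
  using dist_le_vlen[of 0 1] by (simp add: path_length_eq pathstart_def pathfinish_def)

lemma diameter_le_path_length: "diameter (path_image g) \<le> path_length g"
proof -
  have *: "dist (g s) (g t) \<le> path_length g" if "0 \<le> s" "s \<le> t" "t \<le> 1" for s t
    using dist_le_vlen_diff[of s t] that vlen_nonneg[of 0 s] vlen_nonneg[of t 1] vlen_additive[of 0 t 1]
    by (simp add: path_length_eq)
  have "dist x y \<le> path_length g" if xy: "x \<in> path_image g" "y \<in> path_image g" for x y
  proof -
    obtain s t where "s \<in> {0..1}" "t \<in> {0..1}" "x = g s" "y = g t"
      using xy by (auto simp: path_image_def)
    then show ?thesis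
      using *[of s t] *[of t s] by (cases "s \<le> t") (auto simp: dist_commute)
  qed
  then show ?thesis
    unfolding diameter_def using path_image_nonempty[of g] by (auto intro!: cSUP_least)
qed

end

text \<open>Arc length is continuous in the parameter, so the intermediate value theorem shows that
  the choice in \<open>arclength_param\<close> has a witness.\<close>

lemma arclength_param:
  fixes g :: "real \<Rightarrow> 'a::real_normed_vector"
  assumes "rectifiable g" "0 \<le> u" "u \<le> path_length g"
  obtains t where "t \<in> {0..1}" "vlen g 0 t = u" "arclength_param g u = g t"
proof -
  have "\<exists>t. t \<in> {0..1} \<and> path_length (subpath 0 t g) = u"
    using vlen_surj[OF assms] by (auto simp: path_length_subpath)
  from someI_ex[OF this] that show ?thesis
    unfolding arclength_param_def by (metis atLeastAtMost_iff path_length_subpath)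
qed

lemma dist_arclength_param:
  fixes g :: "real \<Rightarrow> 'a::real_normed_vector"
  assumes g: "rectifiable g" and "0 \<le> u" "u \<le> v" "v \<le> path_length g"
  shows "dist (arclength_param g u) (arclength_param g v) \<le> v - u"
proof -
  obtain s where s: "s \<in> {0..1}" "vlen g 0 s = u" "arclength_param g u = g s"
    using arclength_param[OF g, of u] assms by auto
  obtain t where t: "t \<in> {0..1}" "vlen g 0 t = v" "arclength_param g v = g t"
    using arclength_param[OF g, of v] assms by auto
  show ?thesis
  proof (cases "s \<le> t")
    case True
    then show ?thesis using dist_le_vlen_diff[OF g, of s t] s t by auto
  next
    \<comment> \<open>The chosen parameters can come in reverse order only if \<open>u = v\<close>,
      and then the two points coincide.\<close>
    case False
    then have "dist (g t) (g s) \<le> u - v" using dist_le_vlen_diff[OF g, of t s] s t by auto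
    moreover have "u - v \<le> v - u" using assms by simp
    ultimately show ?thesis using s t by (simp add: dist_commute)
  qed
qed

lemma arclength_param_0:
  fixes g :: "real \<Rightarrow> 'a::real_normed_vector"
  assumes g: "rectifiable g" shows "arclength_param g 0 = pathstart g"
proof -
  obtain t where t: "t \<in> {0..1}" "vlen g 0 t = 0" "arclength_param g 0 = g t"
    using arclength_param[OF g, of 0] path_length_nonneg[OF g] by auto
  then show ?thesis using dist_le_vlen[OF g, of 0 t] by (auto simp: pathstart_def)
qed

lemma arclength_param_end:
  fixes g :: "real \<Rightarrow> 'a::real_normed_vector"
  assumes g: "rectifiable g" shows "arclength_param g (path_length g) = pathfinish g"
proof -
  obtain t where t: "t \<in> {0..1}" "vlen g 0 t = path_length g" "arclength_param g (path_length g) = g t"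
    using arclength_param[OF g, of "path_length g"] path_length_nonneg[OF g] by auto
  then show ?thesis
    using dist_le_vlen_diff[OF g, of t 1] by (auto simp: pathfinish_def path_length_eq)
qed

lemma continuous_arclength_param:
  fixes g :: "real \<Rightarrow> 'a::real_normed_vector"
  assumes g: "rectifiable g" shows "continuous_on {0..path_length g} (arclength_param g)"
proof -
  have "dist (arclength_param g x) (arclength_param g y) \<le> 1 * dist x y"
    if "x \<in> {0..path_length g}" "y \<in> {0..path_length g}" for x y
    using that dist_arclength_param[OF g, of x y] dist_arclength_param[OF g, of y x]
    by (cases "x \<le> y") (auto simp: dist_commute dist_real_def)
  then show ?thesis
    by (intro uniformly_continuous_imp_continuous lipschitz_on_uniformly_continuous[of 1] lipschitz_onI) auto
qed

lemma arclength_param_in_path_image: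
  fixes g :: "real \<Rightarrow> 'a::real_normed_vector"
  assumes g: "rectifiable g" and "0 \<le> u" "u \<le> path_length g"
  shows "arclength_param g u \<in> path_image g"
  using arclength_param[OF assms] by (metis image_eqI path_image_def)

section \<open>Discrete quasihyperbolic geodesics\<close>

text \<open>A sublinear bound suffices to turn an inequality t <= C ln (1 + 4t) + 2 into an explicit
  bound for t.\<close>

lemma ln_one_plus_le_sqrt: "ln (1 + y) \<le> 2 * sqrt y" if "0 \<le> y" for y :: real
proof -
  have "ln (1 + y) \<le> ln ((1 + sqrt y)\<^sup>2)"
    using that by (subst ln_le_cancel_iff) (auto simp: power2_sum add_pos_nonneg)
  also have "\<dots> = 2 * ln (1 + sqrt y)"
    using that by (subst ln_realpow) (auto simp: add_pos_nonneg)
  also have "\<dots> \<le> 2 * sqrt y"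
    using ln_add_one_self_le_self[of "sqrt y"] that by simp
  finally show ?thesis .
qed

text \<open>The points \<^term>\<open>x i\<close> form a chain in a domain, \<^term>\<open>a i\<close> is the boundary distance of
  \<^term>\<open>x i\<close>, and \<^term>\<open>W i j\<close> below plays the role of the quasihyperbolic length of a subchain.\<close>

locale quasi_geodesic_chain =
  fixes x :: "nat \<Rightarrow> 'a::metric_space" and a :: "nat \<Rightarrow> real" and N :: nat and C :: real
  assumes C_nonneg: "0 \<le> C"
    and a_pos: "\<And>i. i \<le> N \<Longrightarrow> 0 < a i"
    and a_step: "\<And>i. i < N \<Longrightarrow> \<bar>a (Suc i) - a i\<bar> \<le> dist (x i) (x (Suc i))"
    and step: "\<And>i. i < N \<Longrightarrow> dist (x i) (x (Suc i)) \<le> min (a i) (a (Suc i)) / 2"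
    and short: "\<And>i j. i \<le> j \<Longrightarrow> j \<le> N \<Longrightarrow>
      (\<Sum>l=i..<j. dist (x l) (x (Suc l)) / min (a l) (a (Suc l)))
        \<le> C * ln (1 + dist (x i) (x j) / min (a i) (a j)) + 2"
begin

abbreviation e :: "nat \<Rightarrow> real" where "e i \<equiv> dist (x i) (x (Suc i))"

definition s :: "nat \<Rightarrow> nat \<Rightarrow> real" where "s i j = (\<Sum>l=i..<j. e l)"

definition W :: "nat \<Rightarrow> nat \<Rightarrow> real" where "W i j = (\<Sum>l=i..<j. e l / min (a l) (a (Suc l)))"

text \<open>\<open>A\<close> is what t <= C ln (1 + 4t) + 2 yields for t after the logarithm is
  replaced by a square root, and \<open>B\<close> is the resulting bound for the weight.
  \<open>A'\<close> solves the recursion A'/2 + 1/2 + 2A = A' of the induction in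
  \<open>ascending_half\<close>.\<close>

definition A :: real where "A = 16 * C\<^sup>2 + 4"
definition B :: real where "B = C * ln (1 + 4 * A) + 2"
definition A' :: real where "A' = 4 * A + 1"

lemma A_ge: "4 \<le> A" by (simp add: A_def)

lemma s_nonneg: "0 \<le> s i j" by (simp add: s_def sum_nonneg)

lemma W_nonneg: "j \<le> N \<Longrightarrow> 0 \<le> W i j"
  unfolding W_def by (intro sum_nonneg divide_nonneg_nonneg) (auto intro!: less_imp_le[OF a_pos])

lemma s_add: "i \<le> j \<Longrightarrow> j \<le> k \<Longrightarrow> s i k = s i j + s j k"
  unfolding s_def by (rule sum.atLeastLessThan_concat[symmetric])

lemma W_add: "i \<le> j \<Longrightarrow> j \<le> k \<Longrightarrow> W i k = W i j + W j k"
  unfolding W_def by (rule sum.atLeastLessThan_concat[symmetric])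

lemma dist_le_s: "i \<le> j \<Longrightarrow> dist (x i) (x j) \<le> s i j"
proof (induction j rule: dec_induct)
  case (step n)
  then show ?case using dist_triangle[of "x i" "x (Suc n)" "x n"] by (simp add: s_def)
qed (simp add: s_def)

lemma a_le_add_s: "i \<le> j \<Longrightarrow> j \<le> N \<Longrightarrow> a j \<le> a i + s i j"
proof (induction j rule: dec_induct)
  case (step n)
  then show ?case using a_step[of n] by (simp add: s_def)
qed (simp add: s_def)

lemma a_le_add_s': "i \<le> j \<Longrightarrow> j \<le> N \<Longrightarrow> a i \<le> a j + s i j"
proof (induction j rule: dec_induct)
  case (step n)
  then show ?case using a_step[of n] by (simp add: s_def)
qed (simp add: s_def)

text \<open>A discrete Gronwall estimate: since \<open>a n \<le> a i + s i n\<close>, an edge of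
  weight w multiplies \<open>a i + s i n\<close> by at most 1 + w <= exp w.\<close>

lemma growth: "i \<le> j \<Longrightarrow> j \<le> N \<Longrightarrow> a i + s i j \<le> a i * exp (W i j)"
proof (induction j rule: dec_induct)
  case base
  then show ?case by (simp add: s_def W_def)
next
  case (step n)
  have pos: "0 < a n" "0 < a (Suc n)" "0 < a i" using step a_pos by auto
  have an: "a n \<le> a i + s i n" using a_le_add_s step by simp
  have "e n \<le> (a i + s i n) * (e n / min (a n) (a (Suc n)))"
  proof -
    have "e n * min (a n) (a (Suc n)) \<le> e n * (a i + s i n)"
      using an by (intro mult_left_mono) auto
    then show ?thesis using pos by (simp add: pos_le_divide_eq mult.commute)
  qed
  then have "a i + s i (Suc n) \<le> (a i + s i n) * (1 + e n / min (a n) (a (Suc n)))"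
    using step by (simp add: s_def algebra_simps)
  also have "\<dots> \<le> (a i * exp (W i n)) * exp (e n / min (a n) (a (Suc n)))"
    using step pos an by (intro mult_mono exp_ge_add_one_self) auto
  also have "\<dots> = a i * exp (W i (Suc n))"
    using step by (simp add: W_def exp_add)
  finally show ?case .
qed

lemma sum_reverse:
  fixes f :: "nat \<Rightarrow> real"
  assumes "i \<le> j" "j \<le> N"
  shows "(\<Sum>l=i..<j. f (N - Suc l)) = (\<Sum>l=N-j..<N-i. f l)"
  by (rule sum.reindex_bij_witness[of _ "\<lambda>l. N - Suc l" "\<lambda>l. N - Suc l"]) (use assms in auto)

lemma s_reverse:
  assumes "i \<le> j" "j \<le> N"
  shows "(\<Sum>l=i..<j. dist (x (N - l)) (x (N - Suc l))) = s (N - j) (N - i)"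
proof -
  have "(\<Sum>l=i..<j. dist (x (N - l)) (x (N - Suc l))) = (\<Sum>l=i..<j. e (N - Suc l))"
    using assms by (intro sum.cong) (auto simp: dist_commute Suc_diff_Suc)
  then show ?thesis using sum_reverse[OF assms, of e] by (simp add: s_def)
qed

lemma W_reverse:
  assumes "i \<le> j" "j \<le> N"
  shows "(\<Sum>l=i..<j. dist (x (N - l)) (x (N - Suc l)) / min (a (N - l)) (a (N - Suc l)))
    = W (N - j) (N - i)"
proof -
  have "(\<Sum>l=i..<j. dist (x (N - l)) (x (N - Suc l)) / min (a (N - l)) (a (N - Suc l)))
    = (\<Sum>l=i..<j. (\<lambda>l. e l / min (a l) (a (Suc l))) (N - Suc l))"
    using assms by (intro sum.cong) (auto simp: dist_commute min.commute Suc_diff_Suc)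
  then show ?thesis
    using sum_reverse[OF assms, of "\<lambda>l. e l / min (a l) (a (Suc l))"] by (simp add: W_def)
qed

text \<open>The hypotheses are symmetric, so each one-sided estimate can also be read from the far
  end of the chain.\<close>

lemma reverse: "quasi_geodesic_chain (\<lambda>l. x (N - l)) (\<lambda>l. a (N - l)) N C"
proof
  fix i assume "i < N"
  then have N: "N - i = Suc (N - Suc i)" "N - Suc i < N" by auto
  show "\<bar>a (N - Suc i) - a (N - i)\<bar> \<le> dist (x (N - i)) (x (N - Suc i))"
    using a_step[OF N(2)] unfolding N(1) by (simp add: dist_commute abs_minus_commute)
  show "dist (x (N - i)) (x (N - Suc i)) \<le> min (a (N - i)) (a (N - Suc i)) / 2"
    using step[OF N(2)] unfolding N(1) by (simp add: dist_commute min.commute)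
next
  fix i j assume ij: "i \<le> j" "j \<le> N"
  then show "(\<Sum>l=i..<j. dist (x (N - l)) (x (N - Suc l)) / min (a (N - l)) (a (N - Suc l)))
    \<le> C * ln (1 + dist (x (N - i)) (x (N - j)) / min (a (N - i)) (a (N - j))) + 2"
    using short[of "N - j" "N - i"] unfolding W_reverse[OF ij]
    by (simp add: W_def dist_commute min.commute)
qed (use C_nonneg a_pos in auto)

lemma growth_back:
  assumes "i \<le> j" "j \<le> N" shows "a j + s i j \<le> a j * exp (W i j)"
proof -
  interpret r: quasi_geodesic_chain "\<lambda>l. x (N - l)" "\<lambda>l. a (N - l)" N C by (rule reverse)
  show ?thesis
    using r.growth[of "N - j" "N - i"] assms s_reverse[of "N - j" "N - i"] W_reverse[of "N - j" "N - i"]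
    unfolding r.s_def r.W_def by simp
qed

section \<open>Lengths of stretches on which the height is controlled\<close>

lemma s_over_W:
  assumes "i \<le> j" "j \<le> N" "0 < M" "\<And>l. i \<le> l \<Longrightarrow> l \<le> j \<Longrightarrow> a l \<le> M"
  shows "s i j / M \<le> W i j"
  unfolding s_def W_def sum_divide_distrib
proof (rule sum_mono)
  fix l assume l: "l \<in> {i..<j}"
  then have "0 < min (a l) (a (Suc l))" "min (a l) (a (Suc l)) \<le> M"
    using assms(2) a_pos[of l] a_pos[of "Suc l"] assms(4)[of l] by (auto simp: min.coboundedI1)
  then show "e l / M \<le> e l / min (a l) (a (Suc l))"
    by (intro divide_left_mono) (use assms in auto)
qed

text \<open>The estimate improves itself. With t the length divided by \<open>M\<close>, low heights
  give t <= \<open>W i j\<close>, while the high ends and the near-minimality of the chain give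
  \<open>W i j\<close> <= C ln (1 + 4t) + 2; hence t is bounded.\<close>

lemma doubling:
  assumes "i \<le> j" "j \<le> N" "0 < M" "\<And>l. i \<le> l \<Longrightarrow> l \<le> j \<Longrightarrow> a l \<le> M"
    and "M / 4 \<le> a i" "M / 4 \<le> a j"
  shows "s i j \<le> A * M" "W i j \<le> B"
proof -
  define t where "t = s i j / M"
  have t0: "0 \<le> t" using s_nonneg assms by (simp add: t_def)
  have "dist (x i) (x j) / min (a i) (a j) \<le> s i j / (M / 4)"
    using assms dist_le_s[of i j] s_nonneg[of i j] by (intro frac_le) auto
  also have "\<dots> = 4 * t" using assms by (simp add: t_def)
  finally have d: "dist (x i) (x j) / min (a i) (a j) \<le> 4 * t" .
  have d0: "0 \<le> dist (x i) (x j) / min (a i) (a j)"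
    using assms by (intro divide_nonneg_nonneg) auto
  have W: "W i j \<le> C * ln (1 + 4 * t) + 2"
  proof -
    have "C * ln (1 + dist (x i) (x j) / min (a i) (a j)) \<le> C * ln (1 + 4 * t)"
      using d d0 t0 by (intro mult_left_mono C_nonneg) (auto simp: add_pos_nonneg)
    then show ?thesis using short[of i j] assms by (simp add: W_def)
  qed
  have "t \<le> C * ln (1 + 4 * t) + 2"
    using W s_over_W[OF assms(1-4)] by (simp add: t_def)
  also have "\<dots> \<le> C * (2 * sqrt (4 * t)) + 2"
    using t0 by (intro add_right_mono mult_left_mono C_nonneg ln_one_plus_le_sqrt) simp
  also have "\<dots> = 4 * C * sqrt t + 2"
    by (simp add: real_sqrt_mult)
  \<comment> \<open>Completing the square leaves only t/2 on the right, which the left side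
    absorbs.\<close>
  also have "\<dots> \<le> t / 2 + 8 * C\<^sup>2 + 2"
  proof -
    have "0 \<le> (sqrt t - 4 * C)\<^sup>2" by simp
    also have "\<dots> = t - 8 * C * sqrt t + 16 * C\<^sup>2"
      using t0 by (simp add: power2_diff power_mult_distrib)
    finally show ?thesis by simp
  qed
  finally have t: "t \<le> A" by (simp add: A_def)
  then show "s i j \<le> A * M" using assms by (simp add: t_def pos_divide_le_eq)
  have "C * ln (1 + 4 * t) \<le> C * ln (1 + 4 * A)"
    using t t0 A_ge by (intro mult_left_mono C_nonneg) auto
  then show "W i j \<le> B" using W by (simp add: B_def)
qed

lemma run_max:
  assumes "i \<le> j"
  obtains m where "\<And>l. i \<le> l \<Longrightarrow> l \<le> j \<Longrightarrow> a l \<le> m" "\<exists>l. i \<le> l \<and> l \<le> j \<and> a l = m"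
proof
  show "\<exists>l. i \<le> l \<and> l \<le> j \<and> a l = Max (a ` {i..j})"
    using Max_in[of "a ` {i..j}"] assms by fastforce
qed auto

text \<open>Split at the first index \<^term>\<open>p\<close> with \<^prop>\<open>a p \<ge> m / 2\<close>: up to there the running maximum
  is at most half as large, and from there to the next index of height \<^term>\<open>m\<close> the chain has
  comparable heights at both ends.\<close>

lemma ascending_half:
  assumes "i0 \<le> N" "\<And>l. l \<le> N \<Longrightarrow> a l \<le> a i0"
  shows "t \<le> i0 \<Longrightarrow> (\<And>l. l \<le> t \<Longrightarrow> a l \<le> m) \<Longrightarrow> (\<exists>l\<le>t. a l = m) \<Longrightarrow>
    s 0 t \<le> A' * m \<and> m / 2 \<le> exp B * a t"
proof (induction t arbitrary: m rule: less_induct)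
  case (less t)
  obtain l where l: "l \<le> t" "a l = m" using less.prems by blast
  have m: "0 < m" using l a_pos[of l] less.prems assms by auto
  define p where "p = (LEAST l. m / 2 \<le> a l)"
  have p: "m / 2 \<le> a p" unfolding p_def by (rule LeastI[of _ l]) (use l m in simp)
  have pl: "p \<le> l" unfolding p_def by (rule Least_le) (use l m in simp)
  have below: "a k < m / 2" if "k < p" for k
    using not_less_Least[of k "\<lambda>l. m / 2 \<le> a l"] that by (simp add: p_def)
  have "m \<le> a i0" using assms(2)[of l] l less.prems(1) assms(1) by auto
  \<comment> \<open>The height at \<open>t\<close> may be far below \<open>m\<close>, so the stretch
    is prolonged to \<open>q\<close>, which exists because \<open>i0\<close> is highest. Then
    \<open>doubling\<close> applies with M = 2m, both ends having height at least m/2.\<close>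
  define q where "q = (LEAST l. t \<le> l \<and> m \<le> a l)"
  have q: "t \<le> q" "m \<le> a q"
    using LeastI[of "\<lambda>l. t \<le> l \<and> m \<le> a l" i0] less.prems \<open>m \<le> a i0\<close> by (auto simp: q_def)
  have qi: "q \<le> i0" unfolding q_def by (rule Least_le) (use less.prems \<open>m \<le> a i0\<close> in simp)
  have below': "a k \<le> m" if "k < q" for k
  proof (cases "k \<le> t")
    case False
    then show ?thesis using not_less_Least[of k "\<lambda>l. t \<le> l \<and> m \<le> a l"] that by (simp add: q_def)
  qed (use less.prems in auto)
  \<comment> \<open>An edge has at most half the height of its starting point, so the first index
    reaching \<open>m\<close> overshoots by a factor of at most 3/2.\<close>
  have aq: "a q \<le> 2 * m"
  proof (cases "q = t")
    case True
    then show ?thesis using less.prems(2)[of t] m by simp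
  next
    case False
    then obtain k where k: "q = Suc k" using q by (cases q) auto
    then show ?thesis using below'[of k] a_step[of k] step[of k] qi assms(1) m by auto
  qed
  have pq: "p \<le> q" using pl l q by simp
  have b: "a k \<le> 2 * m" if "k \<le> q" for k
    using below'[of k] aq that m by (cases "k = q") auto
  have dbl: "s p q \<le> A * (2 * m)" "W p q \<le> B"
    using doubling[of p q "2 * m"] pq qi assms(1) m b p q by auto
  have pt: "p \<le> t" using pl l by simp
  have "W p t \<le> B"
    using W_add[of p t q] pt q W_nonneg[of q t] dbl qi assms by auto
  have "a p \<le> a t * exp (W p t)"
    using growth_back[of p t] a_le_add_s'[of p t] pt q qi assms(1) by simp
  also have "\<dots> \<le> a t * exp B"
    using \<open>W p t \<le> B\<close> a_pos[of t] q qi assms(1) by (intro mult_left_mono) auto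
  finally have "a p \<le> exp B * a t" by (simp add: mult.commute)
  then have "m / 2 \<le> exp B * a t" using p by simp
  moreover have "s p t \<le> A * (2 * m)"
    using s_add[of p t q] pt q s_nonneg[of t q] dbl by auto
  \<comment> \<open>Before \<open>p\<close> all heights are below m/2, so the induction hypothesis
    covers the chain up to the predecessor of \<open>p\<close>; the summand m/2 pays for the edge
    into \<open>p\<close>.\<close>
  moreover have "s 0 p \<le> A' * (m / 2) + m / 2"
  proof (cases p)
    case 0
    then show ?thesis using m A_ge by (simp add: s_def A'_def)
  next
    case (Suc k)
    obtain m' where m': "\<And>l. l \<le> k \<Longrightarrow> a l \<le> m'" "\<exists>l\<le>k. a l = m'"
      using run_max[of 0 k] by (metis le0)
    have "m' \<le> m / 2" using m'(2) below Suc by (metis less_Suc_eq_le less_imp_le)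
    have "s 0 k \<le> A' * m'" using less.IH[of k m'] m' pt Suc less.prems(1) by auto
    also have "\<dots> \<le> A' * (m / 2)" using \<open>m' \<le> m / 2\<close> A_ge by (intro mult_left_mono) (auto simp: A'_def)
    finally have "s 0 k \<le> A' * (m / 2)" .
    moreover have "e k \<le> m / 2"
      using step[of k] below[of k] Suc pt less.prems(1) assms(1) m by auto
    ultimately show ?thesis using Suc by (simp add: s_def)
  qed
  ultimately show ?case
    using s_add[of 0 p t] pt m by (simp add: A'_def algebra_simps)
qed

section \<open>Cigar condition and total length for near-minimal chains\<close>

definition K1 :: real where "K1 = 2 * A' * exp B"

lemma K1_pos: "0 < K1" using A_ge by (simp add: K1_def A'_def)

lemma descending_half:
  assumes "i0 \<le> N" "\<And>l. l \<le> N \<Longrightarrow> a l \<le> a i0"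
    and "i0 \<le> t" "t \<le> N" "\<And>l. t \<le> l \<Longrightarrow> l \<le> N \<Longrightarrow> a l \<le> m" "\<exists>l\<le>N. t \<le> l \<and> a l = m"
  shows "s t N \<le> A' * m \<and> m / 2 \<le> exp B * a t"
proof -
  interpret r: quasi_geodesic_chain "\<lambda>l. x (N - l)" "\<lambda>l. a (N - l)" N C by (rule reverse)
  obtain l where l: "l \<le> N" "t \<le> l" "a l = m" using assms by blast
  have "r.s 0 (N - t) \<le> r.A' * m \<and> m / 2 \<le> exp r.B * a (N - (N - t))"
  proof (rule r.ascending_half[of "N - i0"])
    show "\<exists>l\<le>N - t. a (N - l) = m"
      by (rule exI[of _ "N - l"]) (use l in auto)
    show "a (N - k) \<le> m" if "k \<le> N - t" for k
      using assms(4) that by (intro assms(5)) auto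
  qed (use assms in auto)
  then show ?thesis
    using s_reverse[of 0 "N - t"] assms unfolding r.s_def by (simp add: A'_def r.A'_def r.A_def A_def B_def r.B_def)
qed

text \<open>The chain is cut at its highest index \<open>i0\<close>. On the side containing
  \<open>t\<close>, the length to that end is at most \<open>A' * m\<close>, where m is the largest
  height between \<open>t\<close> and the end, and m is itself at most a multiple of
  \<open>a t\<close>. Eliminating m gives \<open>K1\<close>.\<close>

lemma cigar:
  assumes "t \<le> N" shows "min (s 0 t) (s t N) \<le> K1 * a t"
proof -
  obtain i0 where i0: "i0 \<le> N" "\<And>l. l \<le> N \<Longrightarrow> a l \<le> a i0" using run_max[of 0 N] by (metis le0)
  have fin: "y \<le> K1 * a t" if "y \<le> A' * m \<and> m / 2 \<le> exp B * a t" for y m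
  proof -
    have "A' * m \<le> A' * (2 * (exp B * a t))"
      using that A_ge by (intro mult_left_mono) (auto simp: A'_def)
    then show ?thesis using that by (simp add: K1_def)
  qed
  show ?thesis
  proof (cases "t \<le> i0")
    case True
    obtain m where "\<And>l. l \<le> t \<Longrightarrow> a l \<le> m" "\<exists>l\<le>t. a l = m" using run_max[of 0 t] by (metis le0)
    from fin[OF ascending_half[OF i0 True this]] show ?thesis by simp
  next
    case False
    obtain m where m: "\<And>l. t \<le> l \<Longrightarrow> l \<le> N \<Longrightarrow> a l \<le> m" "\<exists>l\<le>N. t \<le> l \<and> a l = m"
      using run_max[OF assms] by metis
    from fin[OF descending_half[OF i0 _ assms m]] False show ?thesis by simp
  qed
qed

text \<open>The term \<open>12 * A'\<close> pays for two tails whose heights stay below 6R; the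
  exponential is the growth over the middle part, which starts at height at most 6R.\<close>

definition K2 :: real where
  "K2 = 12 * A' + 6 * exp (C * ln (1 + (1 + 12 * A') / 4) + 2)"

lemma K2_pos: "0 < K2" using A_ge by (simp add: K2_def A'_def add_pos_pos)

text \<open>If all heights are below 4R, the two monotone halves suffice. Otherwise the chain is cut
  at the first and the last index of height at least 4R. The tails have length O(R), so the cut
  points are O(R) apart; being at depth at least 4R they are joined by bounded weight, and
  \<open>growth\<close> turns weight into length.\<close>

lemma total_length:
  assumes R: "0 < R" "dist (x 0) (x N) \<le> R" "a 0 \<le> 2 * R" "a N \<le> 2 * R"
  shows "s 0 N \<le> K2 * R"
proof -
  obtain i0 where i0: "i0 \<le> N" "\<And>l. l \<le> N \<Longrightarrow> a l \<le> a i0" using run_max[of 0 N] by (metis le0)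
  have A'0: "0 < A'" using A_ge by (simp add: A'_def)
  show ?thesis
  proof (cases "a i0 < 4 * R")
    case True
    have "s 0 i0 \<le> A' * a i0" using ascending_half[OF i0, of i0 "a i0"] i0 by auto
    moreover have "s i0 N \<le> A' * a i0" using descending_half[OF i0, of i0 "a i0"] i0 by auto
    moreover have "A' * a i0 \<le> A' * (4 * R)" using True A'0 by (intro mult_left_mono) auto
    moreover have "8 * A' * R \<le> K2 * R" using R A'0 by (intro mult_right_mono) (auto simp: K2_def)
    ultimately show ?thesis using s_add[of 0 i0 N] i0 by simp
  next
    case False
    define p where "p = (LEAST l. 4 * R \<le> a l)"
    have p: "4 * R \<le> a p" "p \<le> i0" using LeastI[of "\<lambda>l. 4 * R \<le> a l" i0] Least_le[of "\<lambda>l. 4 * R \<le> a l" i0] False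
      by (auto simp: p_def)
    have p': "a k < 4 * R" if "k < p" for k
      using not_less_Least[of k "\<lambda>l. 4 * R \<le> a l"] that by (simp add: p_def)
    \<comment> \<open>The start has height at most 2R, so \<open>p\<close> has a predecessor; its
      height is below 4R and one edge raises it to at most 6R.\<close>
    obtain p1 where p1: "p = Suc p1" using p R by (cases p) auto
    have ap: "a p \<le> 6 * R"
      using p'[of p1] p1 a_step[of p1] step[of p1] p i0 by auto
    define q where "q = (GREATEST l. l \<le> N \<and> 4 * R \<le> a l)"
    have q: "4 * R \<le> a q" "q \<le> N" "i0 \<le> q"
      using GreatestI_nat[of "\<lambda>l. l \<le> N \<and> 4 * R \<le> a l" i0 N] Greatest_le_nat[of "\<lambda>l. l \<le> N \<and> 4 * R \<le> a l" i0 N]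
        False i0 by (auto simp: q_def)
    have q': "a k < 4 * R" if "q < k" "k \<le> N" for k
    proof (rule ccontr)
      assume "\<not> a k < 4 * R"
      then have "k \<le> q"
        using Greatest_le_nat[of "\<lambda>l. l \<le> N \<and> 4 * R \<le> a l" k N] that by (simp add: q_def)
      then show False using that by simp
    qed
    have "q < N" using q R assms(4) by (cases "q = N") auto
    have aq: "a q \<le> 6 * R"
      using q'[of "Suc q"] \<open>q < N\<close> a_step[of q] step[of q] by auto
    have "s 0 p \<le> A' * a p"
    proof -
      have "a l \<le> a p" if "l \<le> p" for l using p'[of l] p that by (cases "l = p") auto
      then show ?thesis using ascending_half[OF i0, of p "a p"] p by blast
    qed
    also have "\<dots> \<le> A' * (6 * R)" using ap A'0 by (intro mult_left_mono) auto
    finally have s1: "s 0 p \<le> A' * (6 * R)" .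
    have "s q N \<le> A' * a q"
    proof -
      have "a l \<le> a q" if "q \<le> l" "l \<le> N" for l using q'[of l] q that by (cases "l = q") auto
      then show ?thesis using descending_half[OF i0, of q "a q"] q by blast
    qed
    also have "\<dots> \<le> A' * (6 * R)" using aq A'0 by (intro mult_left_mono) auto
    finally have s2: "s q N \<le> A' * (6 * R)" .
    have pq: "p \<le> q" using p q by simp
    have "dist (x p) (x q) \<le> (1 + 12 * A') * R"
      using dist_triangle[of "x p" "x q" "x 0"] dist_triangle[of "x 0" "x q" "x N"]
        dist_le_s[of 0 p] dist_le_s[of q N] s1 s2 q R by (simp add: dist_commute algebra_simps)
    then have "dist (x p) (x q) / min (a p) (a q) \<le> ((1 + 12 * A') * R) / (4 * R)"
      using p q R A'0 by (intro frac_le) auto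
    then have d: "dist (x p) (x q) / min (a p) (a q) \<le> (1 + 12 * A') / 4"
      using R by simp
    have "0 \<le> dist (x p) (x q) / min (a p) (a q)"
      using p q R by (intro divide_nonneg_nonneg) auto
    with d have "C * ln (1 + dist (x p) (x q) / min (a p) (a q)) \<le> C * ln (1 + (1 + 12 * A') / 4)"
      using A'0 by (intro mult_left_mono C_nonneg) (auto simp: add_pos_nonneg)
    then have "W p q \<le> C * ln (1 + (1 + 12 * A') / 4) + 2"
      using short[OF pq q(2)] by (simp add: W_def)
    then have "a p * exp (W p q) \<le> (6 * R) * exp (C * ln (1 + (1 + 12 * A') / 4) + 2)"
      using ap R by (intro mult_mono) auto
    then have "s p q \<le> 6 * exp (C * ln (1 + (1 + 12 * A') / 4) + 2) * R"
      using growth[OF pq q(2)] p R unfolding mult.assoc mult.commute[of _ R] by linarith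
    then show ?thesis
      using s1 s2 s_add[of 0 p q] s_add[of 0 q N] pq q by (simp add: K2_def algebra_simps)
  qed
qed

end

section \<open>Polygonal arcs\<close>

text \<open>A majorant stands in for arc length. It may exceed the true length and may jump, so that
  an arc obtained by erasing loops can keep the arc length of the polygon it was cut from.\<close>

definition length_bound :: "(real \<Rightarrow> 'a::metric_space) \<Rightarrow> (real \<Rightarrow> real) \<Rightarrow> bool" where
  "length_bound g \<Lambda> \<longleftrightarrow> (\<forall>u v. 0 \<le> u \<longrightarrow> u \<le> v \<longrightarrow> v \<le> 1 \<longrightarrow> dist (g u) (g v) \<le> \<Lambda> v - \<Lambda> u)"

lemma length_boundD:
  "length_bound g \<Lambda> \<Longrightarrow> 0 \<le> u \<Longrightarrow> u \<le> v \<Longrightarrow> v \<le> 1 \<Longrightarrow> dist (g u) (g v) \<le> \<Lambda> v - \<Lambda> u"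
  by (simp add: length_bound_def)

lemma length_bound_mono:
  "length_bound g \<Lambda> \<Longrightarrow> 0 \<le> u \<Longrightarrow> u \<le> v \<Longrightarrow> v \<le> 1 \<Longrightarrow> \<Lambda> u \<le> \<Lambda> v"
  using length_boundD[of g \<Lambda> u v] zero_le_dist[of "g u" "g v"] by linarith

lemma length_bound_rectifiable: "path g \<Longrightarrow> length_bound g \<Lambda> \<Longrightarrow> rectifiable g"
  by (rule rectifiableI) (auto intro: length_boundD)

lemma length_bound_subpath_length:
  assumes "length_bound g \<Lambda>" "0 \<le> u" "u \<le> v" "v \<le> 1"
  shows "path_length (subpath u v g) \<le> \<Lambda> v - \<Lambda> u"
  unfolding path_length_subpath[OF assms(3)]
  by (rule vlen_bound) (use assms in \<open>auto intro: length_boundD\<close>)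

lemma length_bound_path_length: "length_bound g \<Lambda> \<Longrightarrow> path_length g \<le> \<Lambda> 1 - \<Lambda> 0"
  unfolding path_length_eq by (rule vlen_bound) (auto intro: length_boundD)

lemma length_bound_vlen: "rectifiable g \<Longrightarrow> length_bound g (vlen g 0)"
  unfolding length_bound_def using dist_le_vlen_diff by blast

lemma length_bound_subpath:
  assumes "length_bound g \<Lambda>" "0 \<le> a" "a \<le> b" "b \<le> 1"
  shows "length_bound (subpath a b g) (\<lambda>t. \<Lambda> ((b - a) * t + a))"
  unfolding length_bound_def subpath_def
proof (intro allI impI length_boundD[OF assms(1)])
  fix u v :: real assume uv: "0 \<le> u" "u \<le> v" "v \<le> 1"
  show "0 \<le> (b - a) * u + a" using assms uv by simp
  show "(b - a) * u + a \<le> (b - a) * v + a" using assms uv by (simp add: mult_left_mono)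
  show "(b - a) * v + a \<le> 1" using assms uv mult_left_mono[of v 1 "b - a"] by simp
qed

lemma length_bound_reversepath:
  assumes "length_bound g \<Lambda>" shows "length_bound (reversepath g) (\<lambda>t. - \<Lambda> (1 - t))"
  unfolding length_bound_def reversepath_def
proof (intro allI impI)
  fix u v :: real assume "0 \<le> u" "u \<le> v" "v \<le> 1"
  then show "dist (g (1 - u)) (g (1 - v)) \<le> - \<Lambda> (1 - v) - - \<Lambda> (1 - u)"
    using length_boundD[OF assms, of "1 - v" "1 - u"] by (simp add: dist_commute)
qed

text \<open>The inequality \<open>\<Lambda> 1 \<le> c + M 0\<close>, rather than equality, admits a
  jump at the joint, namely the length of an erased loop.\<close>

lemma length_bound_joinpaths:
  assumes g: "length_bound g \<Lambda>" and h: "length_bound h M"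
    and "pathfinish g = pathstart h" "\<Lambda> 1 \<le> c + M 0"
  shows "length_bound (g +++ h) (\<lambda>t. if t \<le> 1 / 2 then \<Lambda> (2 * t) else c + M (2 * t - 1))"
  unfolding length_bound_def
proof (intro allI impI)
  fix u v :: real assume uv: "0 \<le> u" "u \<le> v" "v \<le> 1"
  consider "v \<le> 1 / 2" | "u \<le> 1 / 2" "1 / 2 < v" | "1 / 2 < u" by linarith
  then show "dist ((g +++ h) u) ((g +++ h) v) \<le>
    (if v \<le> 1 / 2 then \<Lambda> (2 * v) else c + M (2 * v - 1)) -
    (if u \<le> 1 / 2 then \<Lambda> (2 * u) else c + M (2 * u - 1))"
  proof cases
    case 1
    then show ?thesis using uv length_boundD[OF g, of "2 * u" "2 * v"] by (simp add: joinpaths_def)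
  next
    case 2
    then show ?thesis
      using uv length_boundD[OF g, of "2 * u" 1] length_boundD[OF h, of 0 "2 * v - 1"] assms(3,4)
        dist_triangle[of "g (2 * u)" "h (2 * v - 1)" "g 1"]
      by (simp add: joinpaths_def pathstart_def pathfinish_def)
  next
    case 3
    then show ?thesis using uv length_boundD[OF h, of "2 * u - 1" "2 * v - 1"] by (simp add: joinpaths_def)
  qed
qed

lemma length_bound_linepath: "length_bound (linepath a b) (\<lambda>t. c + t * dist a b)"
  unfolding length_bound_def
proof (intro allI impI)
  fix u v :: real assume "u \<le> v"
  have "linepath a b u - linepath a b v = (u - v) *\<^sub>R (b - a)"
    by (simp add: linepath_def algebra_simps)
  then have "dist (linepath a b u) (linepath a b v) = (v - u) * dist a b"
    using \<open>u \<le> v\<close> by (simp add: dist_norm norm_minus_commute)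
  then show "dist (linepath a b u) (linepath a b v) \<le> c + v * dist a b - (c + u * dist a b)"
    by (simp add: algebra_simps)
qed

lemma dist_segment_add:
  fixes q :: "'a::euclidean_space"
  shows "q \<in> closed_segment y z \<Longrightarrow> dist y z = dist y q + dist q z"
  by (metis between between_mem_segment)

text \<open>Loop erasure: when the last edge is appended, the arc built so far is cut at its first
  point on that edge. The function \<^term>\<open>\<Lambda>\<close> records arc length along the original polygon.\<close>

lemma polygonal_arc:
  fixes x :: "nat \<Rightarrow> 'a::euclidean_space"
  defines "S \<equiv> \<lambda>k. \<Sum>l<k. dist (x l) (x (Suc l))"
  assumes "x 0 \<noteq> x n"
  shows "\<exists>p \<Lambda>. arc p \<and> pathstart p = x 0 \<and> pathfinish p = x n \<and> length_bound p \<Lambda> \<and> 0 \<le> \<Lambda> 0 \<and> \<Lambda> 1 \<le> S n \<and>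
    (\<forall>t\<in>{0..1}. \<exists>i<n. p t \<in> closed_segment (x i) (x (Suc i)) \<and> S i \<le> \<Lambda> t \<and> \<Lambda> t \<le> S (Suc i))"
  using assms(2)
proof (induction n)
  case (Suc n)
  let ?z = "x (Suc n)" and ?y = "x n"
  let ?P = "\<lambda>p \<Lambda>. arc p \<and> pathstart p = x 0 \<and> pathfinish p = ?z \<and> length_bound p \<Lambda> \<and> 0 \<le> \<Lambda> 0 \<and> \<Lambda> 1 \<le> S (Suc n) \<and>
    (\<forall>t\<in>{0..1}. \<exists>i<Suc n. p t \<in> closed_segment (x i) (x (Suc i)) \<and> S i \<le> \<Lambda> t \<and> \<Lambda> t \<le> S (Suc i))"
  have S_Suc: "S (Suc n) = S n + dist ?y ?z" by (simp add: S_def)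
  have S_nonneg: "0 \<le> S k" for k by (simp add: S_def sum_nonneg)
  have edge: "linepath q ?z t \<in> closed_segment ?y ?z \<and>
      S n \<le> (S n + dist ?y q) + t * dist q ?z \<and> (S n + dist ?y q) + t * dist q ?z \<le> S (Suc n)"
    if "q \<in> closed_segment ?y ?z" "t \<in> {0..1}" for q t
  proof -
    have "linepath q ?z t \<in> closed_segment q ?z" using linepath_in_path that by blast
    moreover have "closed_segment q ?z \<subseteq> closed_segment ?y ?z"
      using that by (simp add: subset_closed_segment)
    moreover have "t * dist q ?z \<le> 1 * dist q ?z" using that by (intro mult_right_mono) auto
    ultimately show ?thesis using dist_segment_add[OF that(1)] that S_Suc by auto
  qed
  show ?case
  \<comment> \<open>If the start lies on the new edge, the whole earlier arc is a loop and only the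
    rest of this edge is kept.\<close>
  proof (cases "x 0 \<in> closed_segment ?y ?z")
    case True
    have "?P (linepath (x 0) ?z) (\<lambda>t. (S n + dist ?y (x 0)) + t * dist (x 0) ?z)"
    proof (intro conjI ballI)
      show "arc (linepath (x 0) ?z)" using Suc.prems by (rule arc_linepath)
      show "S n + dist ?y (x 0) + 1 * dist (x 0) ?z \<le> S (Suc n)" using edge[OF True, of 1] by simp
    qed (use edge[OF True] S_nonneg[of n] length_bound_linepath in auto)
    then show ?thesis by blast
  next
    case False
    then have "x 0 \<noteq> ?y" by auto
    from Suc.IH[OF this] obtain p \<Lambda> where p: "arc p" "pathstart p = x 0" "pathfinish p = ?y"
      and b: "length_bound p \<Lambda>" and \<Lambda>: "0 \<le> \<Lambda> 0" "\<Lambda> 1 \<le> S n"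
      and loc: "\<And>t. t \<in> {0..1} \<Longrightarrow> \<exists>i<n. p t \<in> closed_segment (x i) (x (Suc i)) \<and> S i \<le> \<Lambda> t \<and> \<Lambda> t \<le> S (Suc i)"
      by blast
    define T where "T = {0..1} \<inter> p -` closed_segment ?y ?z"
    have "continuous_on {0..1} p" using p(1) by (simp add: arc_def path_def)
    then have "closed T" unfolding T_def
      by (intro continuous_closed_preimage) auto
    then have "compact T" unfolding T_def by (metis T_def bounded_closed_interval bounded_subset compact_eq_bounded_closed inf_le1)
    moreover have "1 \<in> T" using p(3) by (simp add: T_def pathfinish_def)
    ultimately obtain t0 where t0: "t0 \<in> T" "\<And>t. t \<in> T \<Longrightarrow> t0 \<le> t"
      using compact_attains_inf[of T] by blast
    have t01: "0 \<le> t0" "t0 \<le> 1" and q: "p t0 \<in> closed_segment ?y ?z" using t0 by (auto simp: T_def)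
    have "t0 \<noteq> 0" using False q p(2) by (auto simp: pathstart_def)
    then have t0_pos: "0 < t0" using t01 by simp
    let ?q = "p t0" and ?r = "subpath 0 t0 p"
    have arc_r: "arc ?r" using p(1) t01 t0_pos by (intro arc_subpath_arc) auto
    have r0: "pathstart ?r = x 0" "pathfinish ?r = ?q" using p(2) by (auto simp: pathstart_def pathfinish_def subpath_def)
    have br: "length_bound ?r (\<lambda>t. \<Lambda> (t0 * t))" using length_bound_subpath[OF b, of 0 t0] t01 by simp
    have \<Lambda>t0: "\<Lambda> t0 \<le> S n" using length_bound_mono[OF b, of t0 1] t01 \<Lambda> by simp
    then have \<Lambda>t0': "\<Lambda> t0 \<le> S n + dist ?y w" for w by (simp add: add_increasing2)
    have loc_r: "\<exists>i<Suc n. ?r t \<in> closed_segment (x i) (x (Suc i)) \<and> S i \<le> \<Lambda> (t0 * t) \<and> \<Lambda> (t0 * t) \<le> S (Suc i)"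
      if "t \<in> {0..1}" for t
    proof -
      have "t0 * t \<in> {0..1}" using that t01 by (auto intro: mult_le_one)
      then show ?thesis using loc[of "t0 * t"] by (auto simp: subpath_def intro: less_SucI)
    qed
    show ?thesis
    \<comment> \<open>Here the cut already happens at the new vertex; appending a degenerate segment
      would destroy injectivity.\<close>
    proof (cases "?q = ?z")
      case True
      have "?P ?r (\<lambda>t. \<Lambda> (t0 * t))"
        using arc_r r0 br True \<Lambda> \<Lambda>t0' S_Suc loc_r by auto
      then show ?thesis by blast
    next
      case False
      let ?g = "?r +++ linepath ?q ?z"
      let ?M = "\<lambda>t. if t \<le> 1 / 2 then \<Lambda> (t0 * (2 * t)) else (S n + dist ?y ?q) + (0 + (2 * t - 1) * dist ?q ?z)"
      \<comment> \<open>By the minimality of \<open>t0\<close> the shortened arc touches the new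
        edge only at its endpoint.\<close>
      have "path_image ?r \<inter> path_image (linepath ?q ?z) \<subseteq> {?q}"
      proof
        fix w assume w: "w \<in> path_image ?r \<inter> path_image (linepath ?q ?z)"
        then obtain t where t: "0 \<le> t" "t \<le> t0" "w = p t"
          using t01 by (auto simp: path_image_subpath)
        have "closed_segment ?q ?z \<subseteq> closed_segment ?y ?z"
          using q by (simp add: subset_closed_segment)
        then have "t \<in> T" using w t t01 by (auto simp: T_def)
        then show "w \<in> {?q}" using t0(2)[of t] t by auto
      qed
      then have "arc ?g"
        using arc_r r0 False by (intro arc_join arc_linepath) auto
      moreover have "length_bound ?g ?M"
        using br length_bound_linepath[of ?q ?z 0] r0 \<Lambda>t0' by (intro length_bound_joinpaths) auto
      moreover have "\<exists>i<Suc n. ?g t \<in> closed_segment (x i) (x (Suc i)) \<and> S i \<le> ?M t \<and> ?M t \<le> S (Suc i)"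
        if "t \<in> {0..1}" for t
      proof (cases "t \<le> 1 / 2")
        case True
        then show ?thesis using loc_r[of "2 * t"] that by (simp add: joinpaths_def)
      next
        case False
        then show ?thesis using edge[OF q, of "2 * t - 1"] that
          by (intro exI[of _ n]) (simp add: joinpaths_def)
      qed
      moreover have "?M 1 \<le> S (Suc n)" using edge[OF q, of 1] by simp
      ultimately have "?P ?g ?M" using r0 \<Lambda> by simp
      then show ?thesis by blast
    qed
  qed
qed simp

section \<open>Boundary distance and the Apollonian distance\<close>

lemma bdist_nonneg: "0 \<le> bdist D x"
  by (simp add: bdist_def infdist_nonneg)

lemma bdist_lipschitz: "\<bar>bdist D x - bdist D y\<bar> \<le> dist x y"
  by (simp add: bdist_def infdist_triangle_abs)

lemma continuous_on_bdist: "continuous_on S h \<Longrightarrow> continuous_on S (\<lambda>u. bdist D (h u))"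
  unfolding bdist_def by (rule continuous_on_infdist)

lemma has_integral_inverse_affine:
  fixes d L :: real
  assumes d: "0 < d" and L: "0 \<le> L"
  shows "((\<lambda>u. 1 / (d + u)) has_integral ln (1 + L / d)) {0..L}"
    and "((\<lambda>u. 1 / (d + (L - u))) has_integral ln (1 + L / d)) {0..L}"
proof -
  have ln: "ln (d + L) - ln d = ln (1 + L / d)"
  proof -
    have "1 + L / d = (d + L) / d" using d by (simp add: field_simps)
    then show ?thesis using d L by (simp add: ln_div)
  qed
  have "((\<lambda>u. 1 / (d + u)) has_integral (ln (d + L) - ln (d + 0))) {0..L}"
    by (rule fundamental_theorem_of_calculus[OF L])
      (use d in \<open>auto intro!: derivative_eq_intros simp flip: has_real_derivative_iff_has_vector_derivative\<close>)
  then show "((\<lambda>u. 1 / (d + u)) has_integral ln (1 + L / d)) {0..L}" using ln by simp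
  have "((\<lambda>u. 1 / (d + (L - u))) has_integral (- ln (d + (L - L)) - - ln (d + (L - 0)))) {0..L}"
    by (rule fundamental_theorem_of_calculus[OF L])
      (use d in \<open>auto intro!: derivative_eq_intros simp flip: has_real_derivative_iff_has_vector_derivative\<close>)
  then show "((\<lambda>u. 1 / (d + (L - u))) has_integral ln (1 + L / d)) {0..L}" using ln by simp
qed

locale domain =
  fixes D :: "'a::euclidean_space set"
  assumes D: "proper_subdomain D"
begin

lemma open_D: "open D" and connected_D: "connected D"
  using D by (auto simp: proper_subdomain_def)

lemma frontier_nonempty: "frontier D \<noteq> {}"
  using D by (simp add: proper_subdomain_def frontier_eq_empty)

lemma bdist_pos: "x \<in> D \<Longrightarrow> 0 < bdist D x"
  unfolding bdist_def using frontier_nonempty open_D frontier_disjoint_eq[of D]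
  by (intro infdist_pos_not_in_closed) auto

lemma bdist_le: "b \<in> frontier D \<Longrightarrow> bdist D x \<le> dist b x"
  unfolding bdist_def using infdist_le[of b "frontier D" x] by (simp add: dist_commute)

text \<open>A connected ball that meets D without lying in it would meet the frontier at less than
  the boundary distance.\<close>

lemma ball_subset:
  assumes "x \<in> D" shows "ball x (bdist D x) \<subseteq> D"
proof (rule ccontr)
  assume not_subset: "\<not> ?thesis"
  have "ball x (bdist D x) \<inter> frontier D \<noteq> {}"
  proof (rule connected_Int_frontier[OF connected_ball])
    show "ball x (bdist D x) \<inter> D \<noteq> {}" using assms bdist_pos[OF assms] by (force intro: exI[of _ x])
  qed (use not_subset in blast)
  then show False using bdist_le[of _ x] by (force simp: dist_commute)
qed

lemma segment_subset:
  assumes "x \<in> D" "dist x y < bdist D x" shows "closed_segment x y \<subseteq> D"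
  using ball_subset[OF assms(1)] assms bdist_pos[OF assms(1)]
  by (intro order_trans[OF closed_segment_subset[of x "ball x (bdist D x)"]]) auto

lemma dist_ratio_bounds:
  assumes "x \<in> D" "y \<in> D" "b \<in> ext_frontier D"
  shows "0 < dist_ratio b x y" "dist_ratio b x y \<le> 1 + dist x y / bdist D y"
proof -
  have pos: "0 < bdist D x" "0 < bdist D y" using assms bdist_pos by auto
  have "0 < dist_ratio b x y \<and> dist_ratio b x y \<le> 1 + dist x y / bdist D y"
  proof (cases b)
    case None
    then show ?thesis using pos by simp
  next
    case (Some p)
    then have p: "p \<in> frontier D" using assms by (auto simp: ext_frontier_def split: if_splits)
    have "bdist D x \<le> dist p x" "bdist D y \<le> dist p y" using p bdist_le by auto
    then have px: "0 < dist p x" "0 < dist p y" using pos by linarith+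
    have "dist p x / dist p y \<le> (dist p y + dist x y) / dist p y"
      using px dist_triangle2[of p x y] by (intro divide_right_mono) auto
    also have "\<dots> = 1 + dist x y / dist p y" using px by (simp add: add_divide_distrib)
    also have "\<dots> \<le> 1 + dist x y / bdist D y"
      using \<open>bdist D y \<le> dist p y\<close> pos by (intro add_left_mono divide_left_mono) (use px in auto)
    finally show ?thesis using px Some by simp
  qed
  then show "0 < dist_ratio b x y" "dist_ratio b x y \<le> 1 + dist x y / bdist D y" by auto
qed

text \<open>Each of the two ratios is controlled by the triangle inequality, which gives the factor
  2. Nonnegativity comes from choosing the same boundary point twice; comparing with that pair
  requires the supremum to be bounded, which is the upper estimate again.\<close>

lemma apollonian_dist_bounds:
  assumes "x \<in> D" "y \<in> D"
  shows "0 \<le> apollonian_dist D x y"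
    and "apollonian_dist D x y \<le> 2 * ln (1 + dist x y / min (bdist D x) (bdist D y))"
proof -
  let ?m = "min (bdist D x) (bdist D y)"
  have m: "0 < ?m" using assms bdist_pos by simp
  have bound: "ln (dist_ratio b x y * dist_ratio c y x) \<le> 2 * ln (1 + dist x y / ?m)"
    if "b \<in> ext_frontier D" "c \<in> ext_frontier D" for b c
  proof -
    note 1 = dist_ratio_bounds[OF assms that(1)] and 2 = dist_ratio_bounds[OF assms(2,1) that(2)]
    have "dist x y / bdist D y \<le> dist x y / ?m" "dist y x / bdist D x \<le> dist x y / ?m"
      using m by (auto simp: dist_commute intro!: divide_left_mono)
    then have "dist_ratio b x y \<le> 1 + dist x y / ?m" "dist_ratio c y x \<le> 1 + dist x y / ?m"
      using 1 2 by linarith+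
    then have "ln (dist_ratio b x y) \<le> ln (1 + dist x y / ?m)" "ln (dist_ratio c y x) \<le> ln (1 + dist x y / ?m)"
      using 1(1) 2(1) by (auto intro: ln_mono)
    then show ?thesis using 1(1) 2(1) by (simp add: ln_mult)
  qed
  obtain p where p: "p \<in> frontier D" using frontier_nonempty by blast
  then have P: "Some p \<in> ext_frontier D" by (simp add: ext_frontier_def)
  have "ln (dist_ratio (Some p) x y * dist_ratio (Some p) y x) \<le> apollonian_dist D x y"
    unfolding apollonian_dist_def
  proof (rule cSUP_upper2[of _ _ "(Some p, Some p)"])
    show "bdd_above ((\<lambda>(a, b). ln (dist_ratio a x y * dist_ratio b y x)) ` (ext_frontier D \<times> ext_frontier D))"
      using bound by (intro bdd_aboveI2[of _ _ "2 * ln (1 + dist x y / ?m)"]) auto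
  qed (use P in auto)
  moreover have "dist_ratio (Some p) x y * dist_ratio (Some p) y x = 1"
    using dist_ratio_bounds(1)[OF assms P] by auto
  ultimately show "0 \<le> apollonian_dist D x y" by simp
  show "apollonian_dist D x y \<le> 2 * ln (1 + dist x y / ?m)"
    unfolding apollonian_dist_def by (rule cSUP_least) (use P bound in auto)
qed


section \<open>Rectifiable paths in a domain\<close>

lemma rect_pathsI:
  assumes "path g" "length_bound g \<Lambda>" "path_image g \<subseteq> D" "pathstart g = x" "pathfinish g = y"
  shows "g \<in> rect_paths D x y" "path_length g \<le> \<Lambda> 1 - \<Lambda> 0"
  using assms length_bound_rectifiable[OF assms(1,2)] length_bound_path_length[OF assms(2)]
  by (auto simp: rect_paths_def)

lemma rect_pathsD:
  assumes "g \<in> rect_paths D x y"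
  shows "rectifiable g" "path g" "path_image g \<subseteq> D" "pathstart g = x" "pathfinish g = y"
  using assms by (auto simp: rect_paths_def rectifiable_def)

text \<open>Naming a length that some path achieves, instead of the infimum, lets concatenation and
  reversal be used without epsilons.\<close>

definition joined_within :: "real \<Rightarrow> 'a \<Rightarrow> 'a \<Rightarrow> bool" where
  "joined_within l x y \<longleftrightarrow> (\<exists>g\<in>rect_paths D x y. path_length g \<le> l)"

lemma joined_within_mono: "joined_within l x y \<Longrightarrow> l \<le> l' \<Longrightarrow> joined_within l' x y"
  unfolding joined_within_def by force

lemma joined_within_segment:
  assumes "closed_segment x y \<subseteq> D" shows "joined_within (dist x y) x y"
proof -
  have "linepath x y \<in> rect_paths D x y \<and> path_length (linepath x y) \<le> dist x y"
    using rect_pathsI[of "linepath x y", OF _ length_bound_linepath[of x y 0]] assms by auto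
  then show ?thesis unfolding joined_within_def by blast
qed

lemma joined_within_sym:
  assumes "joined_within l x y" shows "joined_within l y x"
proof -
  obtain g where g: "g \<in> rect_paths D x y" "path_length g \<le> l" using assms by (auto simp: joined_within_def)
  note gD = rect_pathsD[OF g(1)]
  have "reversepath g \<in> rect_paths D y x \<and> path_length (reversepath g) \<le> path_length g"
    using rect_pathsI[OF _ length_bound_reversepath[OF length_bound_vlen[OF gD(1)]]] gD(2-)
    by (force simp: path_length_eq vlen_0_0[OF gD(1)])
  then show ?thesis unfolding joined_within_def using g(2) order_trans by blast
qed

lemma joined_within_trans:
  assumes "joined_within l x y" "joined_within l' y z" shows "joined_within (l + l') x z"
proof -
  obtain g where g: "g \<in> rect_paths D x y" "path_length g \<le> l" using assms by (auto simp: joined_within_def)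
  obtain h where h: "h \<in> rect_paths D y z" "path_length h \<le> l'" using assms by (auto simp: joined_within_def)
  note gD = rect_pathsD[OF g(1)] and hD = rect_pathsD[OF h(1)]
  have "length_bound (g +++ h) (\<lambda>t. if t \<le> 1 / 2 then vlen g 0 (2 * t) else path_length g + vlen h 0 (2 * t - 1))"
    using length_bound_joinpaths[OF length_bound_vlen[OF gD(1)] length_bound_vlen[OF hD(1)], of "path_length g"]
      gD hD by (simp add: path_length_eq vlen_0_0[OF hD(1)])
  then have "g +++ h \<in> rect_paths D x z \<and> path_length (g +++ h) \<le> path_length g + path_length h"
    using rect_pathsI[of "g +++ h"] gD(2-) hD(2-)
    by (force simp: path_length_eq vlen_0_0[OF gD(1)] path_image_join)
  then show ?thesis unfolding joined_within_def
    using g(2) h(2) by (intro bexI[of _ "g +++ h"]) auto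
qed

text \<open>Being joined by a rectifiable path is an equivalence relation whose classes contain
  balls, by segments, so connectedness leaves a single class.\<close>

lemma rect_paths_nonempty:
  assumes "x \<in> D" "y \<in> D" shows "rect_paths D x y \<noteq> {}"
proof -
  have "\<exists>l. joined_within l x y"
  proof (rule connected_equivalence_relation[OF connected_D assms])
    fix a assume a: "a \<in> D"
    show "\<exists>T. openin (top_of_set D) T \<and> a \<in> T \<and> (\<forall>x\<in>T. \<exists>l. joined_within l a x)"
    proof (intro exI conjI ballI)
      show "openin (top_of_set D) (ball a (bdist D a))"
        using ball_subset[OF a] open_D by (simp add: openin_open_eq)
      show "joined_within (dist a x) a x" if "x \<in> ball a (bdist D a)" for x
        using that segment_subset[OF a] by (intro joined_within_segment) simp
    qed (use bdist_pos[OF a] in simp)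
  next
    show "\<exists>l. joined_within l y x" if "\<exists>l. joined_within l x y" for x y
      using that joined_within_sym by blast
    show "\<exists>l. joined_within l x z" if "\<exists>l. joined_within l x y" "\<exists>l. joined_within l y z" for x y z
      using that joined_within_trans[of _ x y _ z] by blast
  qed
  then show ?thesis by (auto simp: joined_within_def)
qed

lemma bdd_below_path_length: "bdd_below (path_length ` rect_paths D x y)"
  by (rule bdd_belowI2[of _ 0]) (auto simp: rect_paths_def intro: path_length_nonneg)

lemma inner_length_dist_le: "joined_within l x y \<Longrightarrow> inner_length_dist D x y \<le> l"
  unfolding joined_within_def inner_length_dist_def
  by (elim bexE) (rule cINF_lower2[OF bdd_below_path_length])

lemma dist_le_inner_length_dist:
  assumes "x \<in> D" "y \<in> D" shows "dist x y \<le> inner_length_dist D x y"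
  unfolding inner_length_dist_def
proof (rule cINF_greatest[OF rect_paths_nonempty[OF assms]])
  fix g assume "g \<in> rect_paths D x y"
  then show "dist x y \<le> path_length g" using dist_le_path_length[of g] by (auto simp: rect_paths_def)
qed


section \<open>Quasihyperbolic length\<close>

context
  fixes g x y
  assumes g: "g \<in> rect_paths D x y"
begin

lemma arclength_param_in: "0 \<le> u \<Longrightarrow> u \<le> path_length g \<Longrightarrow> arclength_param g u \<in> D"
  using arclength_param_in_path_image[OF rect_pathsD(1)[OF g]] rect_pathsD(3)[OF g] by blast

lemma continuous_on_inverse_bdist:
  "continuous_on {0..path_length g} (\<lambda>u. 1 / bdist D (arclength_param g u))"
proof (intro continuous_on_divide continuous_on_const continuous_on_bdist)
  show "continuous_on {0..path_length g} (arclength_param g)"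
    by (rule continuous_arclength_param[OF rect_pathsD(1)[OF g]])
  show "\<forall>u\<in>{0..path_length g}. bdist D (arclength_param g u) \<noteq> 0"
    using bdist_pos arclength_param_in by force
qed

lemma integrable_inverse_bdist:
  assumes "0 \<le> a" "b \<le> path_length g"
  shows "(\<lambda>u. 1 / bdist D (arclength_param g u)) integrable_on {a..b}"
  by (intro integrable_continuous_interval continuous_on_subset[OF continuous_on_inverse_bdist])
    (use assms in auto)

lemma arclength_integral_nonneg: "0 \<le> arclength_integral (\<lambda>z. 1 / bdist D z) g"
  unfolding arclength_integral_def
  by (rule integral_nonneg) (auto intro: integrable_inverse_bdist simp: bdist_nonneg)

text \<open>At arc length u from an endpoint the boundary distance is at most that of the endpoint
  plus u. The integral is taken from whichever endpoint is closer to the boundary.\<close>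

lemma ln_le_arclength_integral:
  "ln (1 + path_length g / min (bdist D x) (bdist D y)) \<le> arclength_integral (\<lambda>z. 1 / bdist D z) g"
proof -
  let ?L = "path_length g" and ?h = "arclength_param g"
  note rect = rect_pathsD(1)[OF g]
  have L: "0 \<le> ?L" using path_length_nonneg rect by blast
  have x: "?h 0 = x" "x \<in> D" and y: "?h ?L = y" "y \<in> D"
    using arclength_param_0[OF rect] arclength_param_end[OF rect] rect_pathsD(4,5)[OF g]
      arclength_param_in[of 0] arclength_param_in[of ?L] L by auto
  have *: "ln (1 + ?L / d) \<le> arclength_integral (\<lambda>z. 1 / bdist D z) g"
    if d: "0 < d" and I: "(f has_integral ln (1 + ?L / d)) {0..?L}"
      and f: "\<And>u. u \<in> {0..?L} \<Longrightarrow> \<exists>b. bdist D (?h u) \<le> b \<and> f u = 1 / b" for d f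
    unfolding arclength_integral_def integral_unique[OF I, symmetric]
  proof (rule integral_le)
    show "f integrable_on {0..?L}" using I by blast
    fix u assume u: "u \<in> {0..?L}"
    then obtain b where "bdist D (?h u) \<le> b" "f u = 1 / b" using f by blast
    moreover have "0 < bdist D (?h u)" using bdist_pos arclength_param_in u by simp
    ultimately show "f u \<le> 1 / bdist D (?h u)" by (simp add: frac_le)
  qed (rule integrable_inverse_bdist, auto)
  show ?thesis
  proof (cases "bdist D x \<le> bdist D y")
    case True
    have d: "0 < bdist D x" using bdist_pos x by simp
    have "ln (1 + ?L / bdist D x) \<le> arclength_integral (\<lambda>z. 1 / bdist D z) g"
    proof (rule *[OF d has_integral_inverse_affine(1)[OF d L]])
      fix u assume "u \<in> {0..?L}"
      then have "bdist D (?h u) \<le> bdist D x + u"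
        using bdist_lipschitz[of D x "?h u"] dist_arclength_param[OF rect, of 0 u] x by simp
      then show "\<exists>b. bdist D (?h u) \<le> b \<and> 1 / (bdist D x + u) = 1 / b" by blast
    qed
    then show ?thesis using True by (simp add: min_def)
  next
    case False
    have d: "0 < bdist D y" using bdist_pos y by simp
    have "ln (1 + ?L / bdist D y) \<le> arclength_integral (\<lambda>z. 1 / bdist D z) g"
    proof (rule *[OF d has_integral_inverse_affine(2)[OF d L]])
      fix u assume "u \<in> {0..?L}"
      then have "bdist D (?h u) \<le> bdist D y + (?L - u)"
        using bdist_lipschitz[of D "?h u" y] dist_arclength_param[OF rect, of u ?L] y by simp
      then show "\<exists>b. bdist D (?h u) \<le> b \<and> 1 / (bdist D y + (?L - u)) = 1 / b" by blast
    qed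
    then show ?thesis using False by (simp add: min_def)
  qed
qed

text \<open>The path is sampled at equal arc length steps of at most half its minimal boundary
  distance. Between consecutive samples the boundary distance at most doubles the smaller value at
  the ends, which is the factor 2 against the integral.\<close>

lemma fine_chain:
  obtains N z where "z 0 = x" "z N = y" "\<And>i. i \<le> N \<Longrightarrow> z i \<in> D"
    "\<And>i. i < N \<Longrightarrow> dist (z i) (z (Suc i)) \<le> min (bdist D (z i)) (bdist D (z (Suc i))) / 2"
    "(\<Sum>i<N. dist (z i) (z (Suc i))) \<le> path_length g"
    "(\<Sum>i<N. dist (z i) (z (Suc i)) / min (bdist D (z i)) (bdist D (z (Suc i))))
      \<le> 2 * arclength_integral (\<lambda>z. 1 / bdist D z) g"
proof -
  let ?L = "path_length g" and ?h = "arclength_param g"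
  note rect = rect_pathsD(1)[OF g]
  have L: "0 \<le> ?L" using path_length_nonneg rect by blast
  have "continuous_on {0..?L} (\<lambda>u. bdist D (?h u))"
    by (intro continuous_on_bdist continuous_arclength_param rect)
  then obtain v where v: "v \<in> {0..?L}" "\<And>u. u \<in> {0..?L} \<Longrightarrow> bdist D (?h v) \<le> bdist D (?h u)"
    using continuous_attains_inf[of "{0..?L}" "\<lambda>u. bdist D (?h u)"] L by auto
  define m where "m = bdist D (?h v)"
  have m: "0 < m" using v bdist_pos arclength_param_in by (simp add: m_def)
  obtain N where N: "?L / (m / 2) < real N" using reals_Archimedean2 by blast
  moreover have "0 \<le> ?L / (m / 2)" using L m by simp
  ultimately have N0: "0 < real N" by linarith
  define \<delta> where "\<delta> = ?L / real N"
  have \<delta>: "0 \<le> \<delta>" "\<delta> \<le> m / 2" "real N * \<delta> = ?L"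
    using N N0 L m by (auto simp: \<delta>_def field_simps)
  have uL: "real i * \<delta> \<in> {0..?L}" if "i \<le> N" for i
    using \<delta> that mult_right_mono[of "real i" "real N" \<delta>] by auto
  define z where "z i = ?h (real i * \<delta>)" for i
  have zD: "z i \<in> D" if "i \<le> N" for i
    using uL[OF that] arclength_param_in by (simp add: z_def)
  have dz: "dist (z i) (z (Suc i)) \<le> \<delta>" if "i < N" for i
    using dist_arclength_param[OF rect, of "real i * \<delta>" "real (Suc i) * \<delta>"] uL[of i] uL[of "Suc i"] that \<delta>
    by (auto simp: z_def algebra_simps)
  have zm: "m \<le> bdist D (z i)" if "i \<le> N" for i
    using v(2)[OF uL[OF that]] by (simp add: m_def z_def)
  have "(\<Sum>i<k. dist (z i) (z (Suc i)) / min (bdist D (z i)) (bdist D (z (Suc i))))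
      \<le> 2 * integral {0..real k * \<delta>} (\<lambda>u. 1 / bdist D (?h u))" if "k \<le> N" for k
    using that
  proof (induction k)
    case (Suc k)
    let ?a = "real k * \<delta>" and ?b = "real (Suc k) * \<delta>"
    let ?m = "min (bdist D (z k)) (bdist D (z (Suc k)))"
    have ab: "0 \<le> ?a" "?a \<le> ?b" "?b \<le> ?L" "?b - ?a = \<delta>"
      using uL[of k] uL[of "Suc k"] Suc.prems \<delta> by (auto simp: algebra_simps)
    have mm: "m \<le> ?m" using zm[of k] zm[of "Suc k"] Suc.prems by simp
    \<comment> \<open>Each point of the piece is within \<open>\<delta>\<close> of both ends, and
      \<open>\<delta>\<close> is at most m/2, hence at most \<open>?m\<close>.\<close>
    have "integral {?a..?b} (\<lambda>u. 1 / (2 * ?m)) \<le> integral {?a..?b} (\<lambda>u. 1 / bdist D (?h u))"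
    proof (rule integral_le)
      show "(\<lambda>u. 1 / bdist D (?h u)) integrable_on {?a..?b}"
        using ab by (intro integrable_inverse_bdist) auto
      fix u assume u: "u \<in> {?a..?b}"
      have "0 \<le> u" using order_trans[OF ab(1)] u by simp
      then have "dist (?h u) (?h ?a) \<le> \<delta>" "dist (?h u) (?h ?b) \<le> \<delta>"
        using dist_arclength_param[OF rect, of ?a u] dist_arclength_param[OF rect, of u ?b] ab u
        by (auto simp: dist_commute)
      then have "bdist D (?h u) \<le> bdist D (?h ?a) + \<delta>" "bdist D (?h u) \<le> bdist D (?h ?b) + \<delta>"
        using bdist_lipschitz[of D "?h u" "?h ?a"] bdist_lipschitz[of D "?h u" "?h ?b"] by linarith+
      then have "bdist D (?h u) \<le> ?m + \<delta>" by (simp add: z_def min_def)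
      then have "bdist D (?h u) \<le> 2 * ?m" using \<delta> mm m by linarith
      then show "1 / (2 * ?m) \<le> 1 / bdist D (?h u)"
        using bdist_pos[OF arclength_param_in[of u]] \<open>0 \<le> u\<close> u ab m mm by (intro frac_le) auto
    qed (rule integrable_const_ivl)
    then have "\<delta> / ?m \<le> 2 * integral {?a..?b} (\<lambda>u. 1 / bdist D (?h u))"
      using ab by simp
    moreover have "dist (z k) (z (Suc k)) / ?m \<le> \<delta> / ?m"
      using dz[of k] Suc.prems m mm by (intro divide_right_mono) auto
    moreover have "integral {0..?b} (\<lambda>u. 1 / bdist D (?h u)) =
      integral {0..?a} (\<lambda>u. 1 / bdist D (?h u)) + integral {?a..?b} (\<lambda>u. 1 / bdist D (?h u))"
      using ab by (intro Henstock_Kurzweil_Integration.integral_combine[symmetric] integrable_inverse_bdist) auto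
    ultimately show ?case using Suc by simp
  qed simp
  from this[of N] have W: "(\<Sum>i<N. dist (z i) (z (Suc i)) / min (bdist D (z i)) (bdist D (z (Suc i))))
      \<le> 2 * arclength_integral (\<lambda>z. 1 / bdist D z) g"
    by (simp add: arclength_integral_def \<delta>)
  have "(\<Sum>i<N. dist (z i) (z (Suc i))) \<le> (\<Sum>i<N. \<delta>)"
    using dz by (intro sum_mono) auto
  then have S: "(\<Sum>i<N. dist (z i) (z (Suc i))) \<le> ?L" using \<delta> by simp
  have "dist (z i) (z (Suc i)) \<le> min (bdist D (z i)) (bdist D (z (Suc i))) / 2" if "i < N" for i
    using dz[OF that] \<delta>(2) zm[of i] zm[of "Suc i"] that by auto
  then show ?thesis
    using that[of z N] zD S W arclength_param_0[OF rect] arclength_param_end[OF rect] rect_pathsD(4,5)[OF g]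
    by (auto simp: z_def \<delta>)
qed

end

lemma rect_arcs_const: "x \<in> D \<Longrightarrow> (\<lambda>_. x) \<in> rect_arcs D x x \<and> path_length (\<lambda>_. x) \<le> 0"
  using rect_pathsI[of "\<lambda>_. x" "\<lambda>_. 0" x x]
  by (simp add: length_bound_def rect_arcs_def path_def path_image_def pathstart_def pathfinish_def image_constant_conv)

lemma quasihyperbolic_dist_le: "g \<in> rect_paths D x y \<Longrightarrow> quasihyperbolic_dist D x y \<le> arclength_integral (\<lambda>z. 1 / bdist D z) g"
  unfolding quasihyperbolic_dist_def
  by (rule cINF_lower) (auto intro!: bdd_belowI2[of _ 0] arclength_integral_nonneg)

lemma inner_diam_dist_le: "g \<in> rect_arcs D x y \<Longrightarrow> inner_diam_dist D x y \<le> diameter (path_image g)"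
  unfolding inner_diam_dist_def
proof (rule cINF_lower)
  show "bdd_below ((\<lambda>g. diameter (path_image g)) ` rect_arcs D x y)"
    by (rule bdd_belowI2[of _ 0])
      (auto simp: rect_arcs_def rect_paths_def rectifiable_def intro!: diameter_ge_0 compact_imp_bounded compact_path_image)
qed

text \<open>Each edge stays in the ball of half the boundary distance about its first vertex, so the
  polygon lies in D. A point on edge \<open>i\<close> is charged with that edge in both directions,
  whence \<open>Suc i\<close> in one sum and \<open>i\<close> in the other.\<close>

lemma arc_along_chain:
  assumes "x 0 \<noteq> x N" and xD: "\<And>i. i \<le> N \<Longrightarrow> x i \<in> D"
    and fine: "\<And>i. i < N \<Longrightarrow> dist (x i) (x (Suc i)) \<le> min (bdist D (x i)) (bdist D (x (Suc i))) / 2"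
  obtains p where "p \<in> rect_arcs D (x 0) (x N)" "path_length p \<le> (\<Sum>l<N. dist (x l) (x (Suc l)))"
    and "\<And>t. t \<in> {0..1} \<Longrightarrow> \<exists>i<N. dist (x i) (p t) \<le> bdist D (x i) / 2 \<and>
       path_length (subpath 0 t p) \<le> (\<Sum>l<Suc i. dist (x l) (x (Suc l))) \<and>
       path_length (subpath t 1 p) \<le> (\<Sum>l=i..<N. dist (x l) (x (Suc l)))"
proof -
  let ?S = "\<lambda>k. \<Sum>l<k. dist (x l) (x (Suc l))"
  obtain p \<Lambda> where p: "arc p" "pathstart p = x 0" "pathfinish p = x N"
    and b: "length_bound p \<Lambda>" and \<Lambda>: "0 \<le> \<Lambda> 0" "\<Lambda> 1 \<le> ?S N"
    and loc: "\<And>t. t \<in> {0..1} \<Longrightarrow> \<exists>i<N. p t \<in> closed_segment (x i) (x (Suc i)) \<and> ?S i \<le> \<Lambda> t \<and> \<Lambda> t \<le> ?S (Suc i)"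
    using polygonal_arc[OF assms(1)] by blast
  have near: "p t \<in> D \<and> dist (x i) (p t) \<le> bdist D (x i) / 2"
    if "i < N" "p t \<in> closed_segment (x i) (x (Suc i))" for i t
  proof -
    have "dist (p t) (x i) \<le> dist (x i) (x (Suc i))" using dist_in_closed_segment[OF that(2)] by simp
    then have "dist (x i) (p t) \<le> bdist D (x i) / 2" using fine[OF that(1)] by (simp add: dist_commute)
    moreover have "p t \<in> D"
    proof -
      have "p t \<in> ball (x i) (bdist D (x i))"
        using calculation bdist_pos[OF xD[of i]] that by simp
      then show ?thesis using ball_subset[of "x i"] xD[of i] that by auto
    qed
    ultimately show ?thesis by simp
  qed
  have img: "path_image p \<subseteq> D" unfolding path_image_def using loc near by blast
  note r = rect_pathsI[OF arc_imp_path[OF p(1)] b img p(2,3)]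
  have sum_split: "?S N = ?S i + (\<Sum>l=i..<N. dist (x l) (x (Suc l)))" if "i < N" for i
    using sum.atLeastLessThan_concat[of 0 i N "\<lambda>l. dist (x l) (x (Suc l))"] that by (simp add: lessThan_atLeast0)
  show ?thesis
  proof (rule that[of p])
    show "p \<in> rect_arcs D (x 0) (x N)" using r p by (simp add: rect_arcs_def)
    show "path_length p \<le> ?S N" using r(2) \<Lambda> by simp
    fix t :: real assume t: "t \<in> {0..1}"
    then obtain i where i: "i < N" "p t \<in> closed_segment (x i) (x (Suc i))" "?S i \<le> \<Lambda> t" "\<Lambda> t \<le> ?S (Suc i)"
      using loc by blast
    then show "\<exists>i<N. dist (x i) (p t) \<le> bdist D (x i) / 2 \<and>
       path_length (subpath 0 t p) \<le> (\<Sum>l<Suc i. dist (x l) (x (Suc l))) \<and>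
       path_length (subpath t 1 p) \<le> (\<Sum>l=i..<N. dist (x l) (x (Suc l)))"
      using length_bound_subpath_length[OF b, of 0 t] length_bound_subpath_length[OF b, of t 1] t
        near[OF i(1,2)] \<Lambda> sum_split[OF i(1)] by (intro exI[of _ i]) auto
  qed
qed

text \<open>Sampling finely and erasing loops never lengthens a path. This links the metrics defined
  by paths with the notions defined by arcs.\<close>

lemma arc_along_path:
  assumes g: "g \<in> rect_paths D x y"
  obtains p where "p \<in> rect_arcs D x y" "path_length p \<le> path_length g"
proof (cases "x = y")
  case True
  have "x \<in> D" using rect_pathsD[OF g] pathstart_in_path_image by blast
  then show ?thesis
    using that rect_arcs_const[of x] True path_length_nonneg[OF rect_pathsD(1)[OF g]] by fastforce
next
  case False
  obtain N z where z: "z 0 = x" "z N = y" "\<And>i. i \<le> N \<Longrightarrow> z i \<in> D"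
    "\<And>i. i < N \<Longrightarrow> dist (z i) (z (Suc i)) \<le> min (bdist D (z i)) (bdist D (z (Suc i))) / 2"
    and len: "(\<Sum>i<N. dist (z i) (z (Suc i))) \<le> path_length g"
    by (rule fine_chain[OF g], rule that; assumption)
  have "z 0 \<noteq> z N" using False z by simp
  from arc_along_chain[OF this z(3,4)] obtain p
    where "p \<in> rect_arcs D (z 0) (z N)" "path_length p \<le> (\<Sum>i<N. dist (z i) (z (Suc i)))" .
  then show ?thesis using that z(1,2) len by simp
qed

text \<open>The loop-erased arc shows that the length of a path dominates rho_D; the logarithmic
  lower bound for its quasihyperbolic length then finishes.\<close>

lemma j'_dist_le_quasihyperbolic_dist:
  assumes "x \<in> D" "y \<in> D" shows "j'_dist D x y \<le> quasihyperbolic_dist D x y"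
  unfolding quasihyperbolic_dist_def
proof (rule cINF_greatest[OF rect_paths_nonempty[OF assms]])
  fix g assume g: "g \<in> rect_paths D x y"
  let ?m = "min (bdist D x) (bdist D y)"
  have m: "0 < ?m" using assms bdist_pos by simp
  obtain p where p: "p \<in> rect_arcs D x y" "path_length p \<le> path_length g" using arc_along_path[OF g] .
  have "rectifiable p" using p(1) by (auto simp: rect_arcs_def rect_paths_def)
  have \<rho>: "inner_diam_dist D x y \<le> path_length g"
    using inner_diam_dist_le[OF p(1)] diameter_le_path_length[OF \<open>rectifiable p\<close>] p(2) by simp
  have \<rho>0: "0 \<le> inner_diam_dist D x y"
    unfolding inner_diam_dist_def
    using p(1) by (intro cINF_greatest) (auto simp: rect_arcs_def rect_paths_def rectifiable_def intro!: diameter_ge_0 compact_imp_bounded compact_path_image)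
  have "1 + inner_diam_dist D x y / ?m \<le> 1 + path_length g / ?m"
    using \<rho> m by (simp add: divide_right_mono)
  then have "j'_dist D x y \<le> ln (1 + path_length g / ?m)"
    unfolding j'_dist_def using \<rho>0 m by (intro ln_mono) (auto simp: add_pos_nonneg)
  also have "\<dots> \<le> arclength_integral (\<lambda>z. 1 / bdist D z) g"
    by (rule ln_le_arclength_integral[OF g])
  finally show "j'_dist D x y \<le> arclength_integral (\<lambda>z. 1 / bdist D z) g" .
qed

end

section \<open>From A-uniform to inner uniform\<close>

context domain
begin

text \<open>Forgetting the vertices makes it easy to replace part of a chain: only endpoints and
  weights have to match.\<close>

inductive chain_weight :: "'a \<Rightarrow> 'a \<Rightarrow> real \<Rightarrow> bool" where
  trivial: "x \<in> D \<Longrightarrow> chain_weight x x 0"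
| extend: "u \<in> D \<Longrightarrow> v \<in> D \<Longrightarrow> dist u v \<le> min (bdist D u) (bdist D v) / 2 \<Longrightarrow> chain_weight v y w \<Longrightarrow>
    chain_weight u y (dist u v / min (bdist D u) (bdist D v) + w)"

lemma chain_weight_trans:
  "chain_weight u v w \<Longrightarrow> chain_weight v y w' \<Longrightarrow> chain_weight u y (w + w')"
  by (induction rule: chain_weight.induct) (auto simp: add.assoc intro: chain_weight.extend)

lemma chain_weight_nonneg: "chain_weight u v w \<Longrightarrow> 0 \<le> w"
  by (induction rule: chain_weight.induct) (auto simp: bdist_nonneg intro!: add_nonneg_nonneg divide_nonneg_nonneg)

lemma chain_weight_of_chain:
  assumes "\<And>i. i \<le> N \<Longrightarrow> x i \<in> D"
    "\<And>i. i < N \<Longrightarrow> dist (x i) (x (Suc i)) \<le> min (bdist D (x i)) (bdist D (x (Suc i))) / 2"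
    and "i \<le> j" "j \<le> N"
  shows "chain_weight (x i) (x j) (\<Sum>l=i..<j. dist (x l) (x (Suc l)) / min (bdist D (x l)) (bdist D (x (Suc l))))"
  using assms(3)
proof (induction i rule: inc_induct)
  case base
  then show ?case using assms by (simp add: chain_weight.trivial)
next
  case (step i)
  then show ?case
    using chain_weight.extend[of "x i" "x (Suc i)"] assms by (simp add: sum.atLeast_Suc_lessThan)
qed

lemma chain_of_chain_weight:
  "chain_weight u v w \<Longrightarrow> \<exists>N x. x 0 = u \<and> x N = v \<and> (\<forall>i\<le>N. x i \<in> D) \<and>
    (\<forall>i<N. dist (x i) (x (Suc i)) \<le> min (bdist D (x i)) (bdist D (x (Suc i))) / 2) \<and>
    w = (\<Sum>l<N. dist (x l) (x (Suc l)) / min (bdist D (x l)) (bdist D (x (Suc l))))"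
proof (induction rule: chain_weight.induct)
  case (trivial x)
  then show ?case by (intro exI[of _ "0::nat"] exI[of _ "\<lambda>_. x"]) auto
next
  case (extend u v y w)
  then obtain N x where x: "x 0 = v" "x N = y" "\<forall>i\<le>N. x i \<in> D"
    "\<forall>i<N. dist (x i) (x (Suc i)) \<le> min (bdist D (x i)) (bdist D (x (Suc i))) / 2"
    "w = (\<Sum>l<N. dist (x l) (x (Suc l)) / min (bdist D (x l)) (bdist D (x (Suc l))))" by blast
  have "(\<forall>i\<le>Suc N. case_nat u x i \<in> D) \<and> (\<forall>i<Suc N. dist (case_nat u x i) (case_nat u x (Suc i))
      \<le> min (bdist D (case_nat u x i)) (bdist D (case_nat u x (Suc i))) / 2)"
    using x extend.hyps by (auto split: nat.splits)
  then show ?case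
    using x by (intro exI[of _ "Suc N"] exI[of _ "case_nat u x"]) (auto simp: sum.lessThan_Suc_shift simp del: sum.lessThan_Suc)
qed

text \<open>The factor 2 is the cost of sampling; the 1 is twice the error 1/2 in choosing a nearly
  optimal path.\<close>

lemma chain_weight_le_quasihyperbolic:
  assumes "x \<in> D" "y \<in> D"
  shows "\<exists>w. chain_weight x y w \<and> w \<le> 2 * quasihyperbolic_dist D x y + 1"
proof -
  have "quasihyperbolic_dist D x y < quasihyperbolic_dist D x y + 1 / 2" by simp
  then obtain g where g: "g \<in> rect_paths D x y"
    "arclength_integral (\<lambda>z. 1 / bdist D z) g < quasihyperbolic_dist D x y + 1 / 2"
    unfolding quasihyperbolic_dist_def
    by (subst (asm) cINF_less_iff[OF rect_paths_nonempty[OF assms]])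
      (auto intro!: bdd_belowI2[of _ 0] arclength_integral_nonneg)
  obtain N z where z: "z 0 = x" "z N = y" "\<And>i. i \<le> N \<Longrightarrow> z i \<in> D"
    "\<And>i. i < N \<Longrightarrow> dist (z i) (z (Suc i)) \<le> min (bdist D (z i)) (bdist D (z (Suc i))) / 2"
    and w: "(\<Sum>i<N. dist (z i) (z (Suc i)) / min (bdist D (z i)) (bdist D (z (Suc i))))
      \<le> 2 * arclength_integral (\<lambda>z. 1 / bdist D z) g"
    by (rule fine_chain[OF g(1)], rule that; assumption)
  show ?thesis
    using chain_weight_of_chain[of N z 0 N, OF z(3,4)] z(1,2) w g(2)
    by (intro exI[of _ "\<Sum>i<N. dist (z i) (z (Suc i)) / min (bdist D (z i)) (bdist D (z (Suc i)))"])
      (simp add: lessThan_atLeast0)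
qed

text \<open>A chain whose weight is within \<^term>\<open>1\<close> of the infimum has the same property on every subchain,
  since a subchain could be replaced by a better one.\<close>

lemma quasi_geodesic_chain_exists:
  assumes A: "A_uniform K D" and "u \<in> D" "v \<in> D"
  obtains N x where "x 0 = u" "x N = v" "\<And>i. i \<le> N \<Longrightarrow> x i \<in> D"
    "quasi_geodesic_chain x (\<lambda>i. bdist D (x i)) N (4 * \<bar>K\<bar>)"
proof -
  let ?w = "\<lambda>x l. dist (x l) (x (Suc l)) / min (bdist D (x l)) (bdist D (x (Suc l)))"
  \<comment> \<open>The 4 combines the factor 2 of sampling with the factor 2 between the Apollonian
    and the distance ratio metric; \<open>K\<close> may be negative, hence the absolute
    value.\<close>
  have k: "\<exists>w. chain_weight p q w \<and> w \<le> 4 * \<bar>K\<bar> * ln (1 + dist p q / min (bdist D p) (bdist D q)) + 1"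
    if pq: "p \<in> D" "q \<in> D" for p q
  proof -
    have "quasihyperbolic_dist D p q \<le> K * apollonian_dist D p q" using A pq by (simp add: A_uniform_def)
    also have "\<dots> \<le> \<bar>K\<bar> * apollonian_dist D p q"
      using apollonian_dist_bounds[OF pq] by (intro mult_right_mono) auto
    also have "\<dots> \<le> \<bar>K\<bar> * (2 * ln (1 + dist p q / min (bdist D p) (bdist D q)))"
      using apollonian_dist_bounds[OF pq] by (intro mult_left_mono) auto
    finally show ?thesis using chain_weight_le_quasihyperbolic[OF pq] by force
  qed
  define I where "I = Inf {w. chain_weight u v w}"
  have bdd: "bdd_below {w. chain_weight u v w}" by (rule bdd_belowI[of _ 0]) (auto intro: chain_weight_nonneg)
  have "{w. chain_weight u v w} \<noteq> {}" using k[OF assms(2,3)] by blast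
  then obtain w where w: "chain_weight u v w" "w < I + 1"
    using cInf_lessD[of "{w. chain_weight u v w}" "I + 1"] by (auto simp: I_def)
  obtain N x where x: "x 0 = u" "x N = v" "\<forall>i\<le>N. x i \<in> D"
    "\<forall>i<N. dist (x i) (x (Suc i)) \<le> min (bdist D (x i)) (bdist D (x (Suc i))) / 2" "w = (\<Sum>l<N. ?w x l)"
    using chain_of_chain_weight[OF w(1)] by blast
  have sub: "chain_weight (x i) (x j) (\<Sum>l=i..<j. ?w x l)" if "i \<le> j" "j \<le> N" for i j
    using chain_weight_of_chain[of N x i j] x that by blast
  have "quasi_geodesic_chain x (\<lambda>i. bdist D (x i)) N (4 * \<bar>K\<bar>)"
  proof
    show "0 < bdist D (x i)" if "i \<le> N" for i using x that bdist_pos by simp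
    show "\<bar>bdist D (x (Suc i)) - bdist D (x i)\<bar> \<le> dist (x i) (x (Suc i))" for i
      using bdist_lipschitz by (metis dist_commute)
    show "dist (x i) (x (Suc i)) \<le> min (bdist D (x i)) (bdist D (x (Suc i))) / 2" if "i < N" for i
      using x that by simp
    fix i j assume ij: "i \<le> j" "j \<le> N"
    obtain w' where w': "chain_weight (x i) (x j) w'"
      "w' \<le> 4 * \<bar>K\<bar> * ln (1 + dist (x i) (x j) / min (bdist D (x i)) (bdist D (x j))) + 1"
      using k[of "x i" "x j"] x ij by auto
    have "chain_weight u v ((\<Sum>l=0..<i. ?w x l) + w' + (\<Sum>l=j..<N. ?w x l))"
      using chain_weight_trans[OF chain_weight_trans[OF sub[of 0 i] w'(1)] sub[of j N]] ij x by auto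
    then have "I \<le> (\<Sum>l=0..<i. ?w x l) + w' + (\<Sum>l=j..<N. ?w x l)"
      unfolding I_def using bdd by (intro cInf_lower) auto
    moreover have "w = (\<Sum>l=0..<i. ?w x l) + (\<Sum>l=i..<j. ?w x l) + (\<Sum>l=j..<N. ?w x l)"
      using ij by (simp add: x(5) lessThan_atLeast0 sum.atLeastLessThan_concat)
    \<comment> \<open>The additive 2 consists of 1 for the near-minimality of the whole chain and 1
      from the competitor \<open>w'\<close>.\<close>
    ultimately show "(\<Sum>l=i..<j. ?w x l) \<le>
        4 * \<bar>K\<bar> * ln (1 + dist (x i) (x j) / min (bdist D (x i)) (bdist D (x j))) + 2"
      using w(2) w'(2) by linarith
  qed simp
  then show ?thesis using that[of x N] x by blast
qed

lemma A_uniform_imp_inner_uniform: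
  assumes A: "A_uniform K D"
  defines "c \<equiv> 2 * quasi_geodesic_chain.K1 (4 * \<bar>K\<bar>) + quasi_geodesic_chain.K2 (4 * \<bar>K\<bar>) + 1"
  shows "inner_uniform c D"
  unfolding inner_uniform_def
proof (intro ballI)
  \<comment> \<open>\<open>K1\<close> and \<open>K2\<close> depend on the constant of the locale
    alone, so a one-point chain certifies their signs.\<close>
  interpret single: quasi_geodesic_chain "\<lambda>_. 0 :: 'a" "\<lambda>_. 1" 0 "4 * \<bar>K\<bar>"
    by unfold_locales auto
  have c: "0 < quasi_geodesic_chain.K1 (4 * \<bar>K\<bar>)" "0 < quasi_geodesic_chain.K2 (4 * \<bar>K\<bar>)"
    by (rule single.K1_pos, rule single.K2_pos)
  fix z1 z2 assume z: "z1 \<in> D" "z2 \<in> D"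
  have lam: "dist z1 z2 \<le> inner_length_dist D z1 z2" by (rule dist_le_inner_length_dist[OF z])
  then have lam0: "0 \<le> inner_length_dist D z1 z2" using zero_le_dist order_trans by blast
  have c1: "1 \<le> c" using c by (simp add: c_def)
  show "\<exists>g\<in>rect_arcs D z1 z2. (\<forall>t\<in>{0..1}. min (path_length (subpath 0 t g)) (path_length (subpath t 1 g))
          \<le> c * bdist D (g t)) \<and> path_length g \<le> c * inner_length_dist D z1 z2"
  \<comment> \<open>The negated case is exactly the height hypothesis of \<open>total_length\<close>
    with R = |z1-z2|.\<close>
  proof (cases "2 * dist z1 z2 < bdist D z1 \<or> 2 * dist z1 z2 < bdist D z2")
    case True
    then obtain p where p: "p \<in> {z1, z2}" "2 * dist z1 z2 < bdist D p" by blast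
    let ?g = "linepath z1 z2"
    have b: "length_bound ?g (\<lambda>t. 0 + t * dist z1 z2)" by (rule length_bound_linepath)
    \<comment> \<open>Each \<open>q\<close> on the segment is within |z1-z2| of the deep endpoint
      \<open>p\<close>, so more than |z1-z2| of depth is left at \<open>q\<close>.\<close>
    have seg: "q \<in> D \<and> dist z1 z2 \<le> bdist D q" if "q \<in> closed_segment z1 z2" for q
    proof -
      have "dist q p \<le> dist z1 z2" using dist_in_closed_segment[OF that] p(1) by auto
      then have q: "dist p q \<le> dist z1 z2" "dist p q < bdist D p"
        using p(2) zero_le_dist[of z1 z2] by (auto simp: dist_commute simp del: zero_le_dist)
      have "p \<in> D" using p(1) z by blast
      then have "q \<in> D" using q(2) ball_subset[of p] by (meson mem_ball subsetD)
      moreover have "dist z1 z2 \<le> bdist D q" using bdist_lipschitz[of D p q] q p(2) by linarith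
      ultimately show ?thesis by simp
    qed
    have r: "?g \<in> rect_paths D z1 z2" "path_length ?g \<le> dist z1 z2"
    proof -
      have "path_image ?g \<subseteq> D" using seg by auto
      then show "?g \<in> rect_paths D z1 z2" "path_length ?g \<le> dist z1 z2"
        using rect_pathsI[OF _ b] by auto
    qed
    have "?g \<in> rect_arcs D z1 z2"
      using r(1) by (cases "z1 = z2") (auto simp: rect_arcs_def)
    moreover have "min (path_length (subpath 0 t ?g)) (path_length (subpath t 1 ?g)) \<le> c * bdist D (?g t)"
      if t: "t \<in> {0..1}" for t
    proof -
      have "path_length (subpath 0 t ?g) \<le> t * dist z1 z2"
        using length_bound_subpath_length[OF b, of 0 t] t by simp
      also have "\<dots> \<le> 1 * dist z1 z2" using t by (intro mult_right_mono) auto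
      also have "\<dots> \<le> 1 * bdist D (?g t)" using seg[OF linepath_in_path[OF t]] by simp
      also have "\<dots> \<le> c * bdist D (?g t)" using c1 by (intro mult_right_mono bdist_nonneg)
      finally show ?thesis by simp
    qed
    moreover have "path_length ?g \<le> c * inner_length_dist D z1 z2"
      using r(2) lam mult_right_mono[OF c1 lam0] by simp
    ultimately show ?thesis by blast
  next
    case False
    obtain N x where x: "x 0 = z1" "x N = z2" and xD: "\<And>i. i \<le> N \<Longrightarrow> x i \<in> D"
      and Q: "quasi_geodesic_chain x (\<lambda>i. bdist D (x i)) N (4 * \<bar>K\<bar>)"
      by (rule quasi_geodesic_chain_exists[OF A z], rule that; assumption)
    interpret Q: quasi_geodesic_chain x "\<lambda>i. bdist D (x i)" N "4 * \<bar>K\<bar>" by (rule Q)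
    have R: "0 < dist z1 z2" using False bdist_pos[OF z(1)] by linarith
    then have "x 0 \<noteq> x N" using x by auto
    obtain p where p: "p \<in> rect_arcs D (x 0) (x N)" "path_length p \<le> (\<Sum>l<N. dist (x l) (x (Suc l)))"
      and near: "\<And>t. t \<in> {0..1} \<Longrightarrow> \<exists>i<N. dist (x i) (p t) \<le> bdist D (x i) / 2 \<and>
       path_length (subpath 0 t p) \<le> (\<Sum>l<Suc i. dist (x l) (x (Suc l))) \<and>
       path_length (subpath t 1 p) \<le> (\<Sum>l=i..<N. dist (x l) (x (Suc l)))"
      by (rule arc_along_chain[where x = x and N = N, OF \<open>x 0 \<noteq> x N\<close> xD Q.step]) (assumption+, rule that)
    have "min (path_length (subpath 0 t p)) (path_length (subpath t 1 p)) \<le> c * bdist D (p t)"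
      if t: "t \<in> {0..1}" for t
    proof -
      obtain i where i: "i < N" "dist (x i) (p t) \<le> bdist D (x i) / 2"
        "path_length (subpath 0 t p) \<le> (\<Sum>l<Suc i. dist (x l) (x (Suc l)))"
        "path_length (subpath t 1 p) \<le> (\<Sum>l=i..<N. dist (x l) (x (Suc l)))"
        using near[OF t] by blast
      have "path_length (subpath 0 t p) \<le> Q.s 0 i + bdist D (x i) / 2"
        using i(3) Q.step[OF i(1)] by (simp add: Q.s_def lessThan_atLeast0)
      moreover have "path_length (subpath t 1 p) \<le> Q.s i N"
        using i(4) by (simp add: Q.s_def)
      ultimately have "min (path_length (subpath 0 t p)) (path_length (subpath t 1 p))
          \<le> min (Q.s 0 i) (Q.s i N) + bdist D (x i) / 2"
        using bdist_nonneg[of D "x i"] by (auto simp: min_def)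
      also have "\<dots> \<le> Q.K1 * bdist D (x i) + bdist D (x i) / 2"
        using Q.cigar[of i] i(1) by simp
      \<comment> \<open>The arc point has at least half the depth of the vertex \<open>x i\<close>,
        which explains \<open>2 * K1 + 1\<close> in the choice of \<open>c\<close>.\<close>
      also have "\<dots> = (2 * Q.K1 + 1) * (bdist D (x i) / 2)" by (simp add: algebra_simps)
      also have "\<dots> \<le> c * bdist D (p t)"
      proof (rule mult_mono)
        show "bdist D (x i) / 2 \<le> bdist D (p t)" using bdist_lipschitz[of D "x i" "p t"] i(2) by linarith
      qed (use c bdist_nonneg in \<open>auto simp: c_def\<close>)
      finally show ?thesis .
    qed
    moreover have "path_length p \<le> c * inner_length_dist D z1 z2"
    proof -
      have "path_length p \<le> Q.K2 * dist z1 z2"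
        using Q.total_length[OF R] p(2) x False by (simp add: Q.s_def lessThan_atLeast0)
      also have "\<dots> \<le> c * inner_length_dist D z1 z2"
        using c lam by (intro mult_mono) (auto simp: c_def)
      finally show ?thesis .
    qed
    moreover have "p \<in> rect_arcs D z1 z2" using p(1) x by simp
    ultimately show ?thesis by blast
  qed
qed

end

section \<open>From inner uniform to A-uniform\<close>

text \<open>Bernoulli's inequality moves a factor out of the logarithm without an additive error, so
  the comparison survives for points arbitrarily close together.\<close>

lemma ln_scale_le:
  fixes a t :: real
  assumes "0 \<le> t" "0 \<le> a" shows "ln (1 + a * t) \<le> real (nat \<lceil>a\<rceil>) * ln (1 + t)"
proof -
  have "1 + a * t \<le> 1 + real (nat \<lceil>a\<rceil>) * t"
    using assms by (simp add: mult_right_mono real_nat_ceiling_ge)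
  also have "\<dots> \<le> (1 + t) ^ nat \<lceil>a\<rceil>"
    using Bernoulli_inequality[of t "nat \<lceil>a\<rceil>"] assms by simp
  finally have "ln (1 + a * t) \<le> ln ((1 + t) ^ nat \<lceil>a\<rceil>)"
    using assms by (intro ln_mono) (auto simp: add_pos_nonneg)
  then show ?thesis using assms by (simp add: ln_realpow add_pos_nonneg)
qed

context domain
begin

section \<open>Inner length versus inner diameter\<close>

lemma inner_uniform_mono:
  assumes "inner_uniform c D" "c \<le> c'" shows "inner_uniform c' D"
  unfolding inner_uniform_def
proof (intro ballI)
  fix z1 z2 assume z: "z1 \<in> D" "z2 \<in> D"
  then have "0 \<le> inner_length_dist D z1 z2"
    using dist_le_inner_length_dist[OF z] zero_le_dist order_trans by blast
  then have "c * inner_length_dist D z1 z2 \<le> c' * inner_length_dist D z1 z2"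
    using assms(2) by (rule mult_right_mono[rotated])
  moreover have "c * bdist D q \<le> c' * bdist D q" for q
    using assms(2) bdist_nonneg by (rule mult_right_mono)
  moreover obtain g where "g\<in>rect_arcs D z1 z2"
    "\<forall>t\<in>{0..1}. min (path_length (subpath 0 t g)) (path_length (subpath t 1 g)) \<le> c * bdist D (g t)"
    "path_length g \<le> c * inner_length_dist D z1 z2"
    using assms(1) z unfolding inner_uniform_def by blast
  ultimately show "\<exists>g\<in>rect_arcs D z1 z2. (\<forall>t\<in>{0..1}. min (path_length (subpath 0 t g)) (path_length (subpath t 1 g))
          \<le> c' * bdist D (g t)) \<and> path_length g \<le> c' * inner_length_dist D z1 z2"
    by (meson order_trans)
qed

lemma rect_arcs_subset: "rect_arcs D x y \<subseteq> rect_paths D x y"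
  by (auto simp: rect_arcs_def)

text \<open>The inner uniform arc from \<open>z\<close> to \<open>w\<close> has length at least 2r.
  At arc length r from \<open>z\<close> the remaining part is no shorter, so the cigar condition
  bounds r itself.\<close>

lemma deep_point:
  assumes "inner_uniform c D" "z \<in> D" "w \<in> D" "0 \<le> r" "2 * r \<le> inner_length_dist D z w"
  shows "\<exists>q\<in>D. joined_within r z q \<and> r \<le> c * bdist D q"
proof -
  obtain g where g: "g \<in> rect_paths D z w"
    and cig: "\<And>t. t \<in> {0..1} \<Longrightarrow> min (path_length (subpath 0 t g)) (path_length (subpath t 1 g)) \<le> c * bdist D (g t)"
    using assms(1-3) rect_arcs_subset unfolding inner_uniform_def by blast
  note gD = rect_pathsD[OF g]
  have "joined_within (path_length g) z w" using g by (auto simp: joined_within_def)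
  then have L: "2 * r \<le> path_length g" using inner_length_dist_le assms(5) order_trans by blast
  obtain t where t: "t \<in> {0..1}" "vlen g 0 t = r" using vlen_surj[OF gD(1), of r] L assms(4) by auto
  have b: "length_bound (subpath 0 t g) (\<lambda>s. vlen g 0 (t * s))"
    using length_bound_subpath[OF length_bound_vlen[OF gD(1)], of 0 t] t by simp
  have "path_image (subpath 0 t g) \<subseteq> D" using path_image_subpath_subset[of 0 t g] gD(3) t by force
  have "subpath 0 t g \<in> rect_paths D z (g t) \<and> path_length (subpath 0 t g) \<le> r"
  proof -
    have "g 0 = z" using gD(4) by (simp add: pathstart_def)
    then show ?thesis
      using rect_pathsI[OF _ b, of z "g t"] gD(2) t vlen_0_0[OF gD(1)] \<open>path_image (subpath 0 t g) \<subseteq> D\<close> by simp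
  qed
  moreover have "r \<le> c * bdist D (g t)"
    using cig[OF t(1)] t L vlen_additive[OF gD(1), of 0 t 1] by (auto simp: path_length_subpath path_length_eq[of g])
  moreover have "g t \<in> D" using gD(3) t by (auto simp: path_image_def)
  ultimately show ?thesis by (auto simp: joined_within_def)
qed

lemma joined_within_dist: "joined_within l x y \<Longrightarrow> dist x y \<le> l"
  unfolding joined_within_def using dist_le_path_length rect_pathsD by (metis order_trans)

lemma joined_within_less: "x \<in> D \<Longrightarrow> y \<in> D \<Longrightarrow> inner_length_dist D x y < l \<Longrightarrow> joined_within l x y"
  unfolding joined_within_def inner_length_dist_def
  by (subst (asm) cINF_less_iff[OF rect_paths_nonempty bdd_below_path_length]) (auto intro: less_imp_le)

text \<open>From each point of a path of diameter \<^term>\<open>r\<close> one can travel a length \<^term>\<open>r\<close> to a point at distance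
  at least \<^term>\<open>r / c\<close> from the boundary. Sorting the points of the path according to which of boundedly many
  balls of radius \<^term>\<open>r / (2 * c)\<close> contains that deep point, points of the same class are joined
  within length \<^term>\<open>3 * r\<close>, and connectedness of the path links the classes.\<close>

lemma joined_within_diameter:
  assumes U: "inner_uniform c D" and c: "1 \<le> c" and Q: "finite (Q :: 'a set)" "cball 0 2 \<subseteq> (\<Union>q\<in>Q. ball q (1 / (2 * c)))"
    and g: "g \<in> rect_paths D x y" and r: "0 < r" "diameter (path_image g) \<le> r"
  shows "joined_within ((4 + 4 * real (card (Q \<times> Q))) * r) x y"
proof -
  let ?S = "path_image g"
  note gD = rect_pathsD[OF g]
  have S: "x \<in> ?S" "y \<in> ?S" "connected ?S" "?S \<subseteq> D"
    using gD by (auto intro: connected_path_image)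
  have diam: "dist a b \<le> r" if "a \<in> ?S" "b \<in> ?S" for a b
    using diameter_bounded_bound[OF compact_imp_bounded[OF compact_path_image[OF gD(2)]] that] r(2) by simp
  show ?thesis
  \<comment> \<open>Without a far point \<open>w\<close> there need be no deep point; but then some
    \<open>z\<close> on the path reaches all of D within 2r, and going through it costs 4r.\<close>
  proof (cases "\<exists>z\<in>?S. \<forall>w\<in>D. inner_length_dist D z w < 2 * r")
    case True
    then obtain z where "z \<in> ?S" "\<And>w. w \<in> D \<Longrightarrow> joined_within (2 * r) z w"
      using S(4) joined_within_less by blast
    then have "joined_within (2 * r) x z" "joined_within (2 * r) z y"
      using S joined_within_sym by blast+
    from joined_within_trans[OF this] show ?thesis
      by (rule joined_within_mono) (use r in \<open>simp add: algebra_simps\<close>)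
  next
    case False
    have "\<exists>q. joined_within r z q \<and> q \<in> D \<and> r \<le> c * bdist D q" if "z \<in> ?S" for z
      using deep_point[OF U, of z _ r] False that S(4) r(1) by (meson less_imp_le not_less subsetD)
    then obtain q where q: "\<And>z. z \<in> ?S \<Longrightarrow> joined_within r z (q z) \<and> q z \<in> D \<and> r \<le> c * bdist D (q z)" by metis
    \<comment> \<open>Deep points lie within 2r of \<open>x\<close>: r along the path's diameter and
      r for the excursion. Rescaling by r makes the covering \<open>Q\<close> independent of D and
      of the path.\<close>
    define e where "e z = (1 / r) *\<^sub>R (q z - x)" for z
    have "\<exists>p\<in>Q. dist p (e z) < 1 / (2 * c)" if z: "z \<in> ?S" for z
    proof -
      have "dist x (q z) \<le> 2 * r"
        using dist_triangle[of x "q z" z] diam[OF S(1) z] joined_within_dist[of r z "q z"] q[OF z] by linarith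
      moreover have "norm (e z) = dist x (q z) / r"
        using r by (simp add: e_def dist_norm norm_minus_commute)
      ultimately have "e z \<in> cball 0 2" using r by (simp add: divide_le_eq)
      then have "e z \<in> (\<Union>q\<in>Q. ball q (1 / (2 * c)))" using Q(2) by blast
      then show ?thesis by auto
    qed
    then obtain cls where cls: "\<And>z. z \<in> ?S \<Longrightarrow> cls z \<in> Q \<and> dist (cls z) (e z) < 1 / (2 * c)" by metis
    have same: "joined_within (3 * r) z z'" if z: "z \<in> ?S" "z' \<in> ?S" "cls z = cls z'" for z z'
    proof -
      have "dist (e z) (e z') < 1 / c"
        using dist_triangle3[of "e z" "e z'" "cls z"] cls[OF z(1)] cls[OF z(2)] z(3) by simp
      moreover have "dist (e z) (e z') = dist (q z) (q z') / r"
        using r by (simp add: e_def dist_norm scaleR_diff_right[symmetric])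
      ultimately have d: "dist (q z) (q z') < r / c" using r c by (simp add: field_simps)
      also have "r / c \<le> bdist D (q z)" using q[OF z(1)] c by (simp add: divide_le_eq mult.commute)
      finally have "joined_within (dist (q z) (q z')) (q z) (q z')"
        using q[OF z(1)] segment_subset by (intro joined_within_segment) auto
      moreover have "dist (q z) (q z') \<le> r"
        using d r c by (smt (verit) divide_le_eq_1_pos divide_right_mono frac_le div_by_1)
      ultimately have "joined_within r (q z) (q z')" by (rule joined_within_mono)
      then show ?thesis
        using joined_within_trans[OF joined_within_trans[of r z "q z" r "q z'"] joined_within_sym[of r z' "q z'"]] q z
        by (auto simp: algebra_simps)
    qed
    \<comment> \<open>A finite graph on the classes: an edge records that some pair of
      representatives is joined within r.\<close>
    define E where "E = {(p, p'). p \<in> Q \<and> p' \<in> Q \<and> (\<exists>z\<in>?S. \<exists>z'\<in>?S. cls z = p \<and> cls z' = p' \<and> joined_within r z z')}"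
    have E: "E \<subseteq> Q \<times> Q" by (auto simp: E_def)
    \<comment> \<open>Each edge of the graph costs r for the crossing and 3r to change the
      representative inside the new class.\<close>
    have pow: "joined_within ((3 + 4 * real k) * r) z z'"
      if "(cls z, p) \<in> E ^^ k" "z \<in> ?S" "z' \<in> ?S" "cls z' = p" for k p z z'
      using that
    proof (induction k arbitrary: p z')
      case 0
      then show ?case using same by simp
    next
      case (Suc k)
      then obtain p' where p': "(cls z, p') \<in> E ^^ k" "(p', p) \<in> E" by auto
      then obtain a b where ab: "a \<in> ?S" "b \<in> ?S" "cls a = p'" "cls b = p" "joined_within r a b"
        by (auto simp: E_def)
      have "joined_within (((3 + 4 * real k) * r + r) + 3 * r) z z'"
        using joined_within_trans[OF joined_within_trans[OF Suc.IH[OF p'(1) Suc.prems(2) ab(1,3)] ab(5)] same[of b z']]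
          ab Suc.prems by simp
      then show ?case by (simp add: algebra_simps)
    qed
    have "sym E" using joined_within_sym by (fastforce simp: E_def sym_def)
    have "(cls x, cls y) \<in> E\<^sup>*"
    proof (rule connected_equivalence_relation[OF S(3,1,2)])
      show "(cls b, cls a) \<in> E\<^sup>*" if "(cls a, cls b) \<in> E\<^sup>*" for a b
        using that sym_rtrancl[OF \<open>sym E\<close>] by (auto simp: sym_def)
      show "(cls a, cls b') \<in> E\<^sup>*" if "(cls a, cls b) \<in> E\<^sup>*" "(cls b, cls b') \<in> E\<^sup>*" for a b b'
        using that by (rule rtrancl_trans)
      fix a assume a: "a \<in> ?S"
      let ?T = "?S \<inter> ball a (min r (bdist D a))"
      have "(cls a, cls b) \<in> E\<^sup>*" if b: "b \<in> ?T" for b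
      proof -
        have "joined_within (dist a b) a b" using segment_subset[of a b] a b S(4) by (intro joined_within_segment) auto
        then have "joined_within r a b" by (rule joined_within_mono) (use b in simp)
        then have "(cls a, cls b) \<in> E" using a b cls by (auto simp: E_def)
        then show ?thesis by blast
      qed
      moreover have "a \<in> ?T" using a S(4) r(1) bdist_pos[of a] by auto
      moreover have "openin (top_of_set ?S) ?T" by (simp add: openin_open_Int)
      ultimately show "\<exists>T. openin (top_of_set ?S) T \<and> a \<in> T \<and> (\<forall>b\<in>T. (cls a, cls b) \<in> E\<^sup>*)" by blast
    qed
    moreover have "finite E" using E Q(1) finite_subset by blast
    \<comment> \<open>In a finite relation reachability needs at most \<open>card E\<close> steps,
      so the bound does not depend on the length of the path.\<close>
    ultimately obtain k where k: "k \<le> card E" "(cls x, cls y) \<in> E ^^ k"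
      using rtrancl_finite_eq_relpow[of E] by auto
    have "card E \<le> card (Q \<times> Q)" using E Q(1) by (intro card_mono) auto
    then have "3 + 4 * real k \<le> 4 + 4 * real (card (Q \<times> Q))" using k(1) by simp
    then have "(3 + 4 * real k) * r \<le> (4 + 4 * real (card (Q \<times> Q))) * r"
      using r by (intro mult_right_mono) auto
    then show ?thesis using joined_within_mono pow[OF k(2) S(1,2) refl] by blast
  qed
qed

text \<open>If the part from \<open>x\<close> of length u satisfies u <= c d, then d(x) + u <= d +
  2u <= (1 + 2c) d by the Lipschitz property, and likewise from \<open>y\<close>. Integrating the
  sum of both majorants avoids cutting the arc at its midpoint.\<close>

lemma quasihyperbolic_dist_le_of_inner_uniform:
  assumes U: "inner_uniform c D" and c: "0 \<le> c" and xy: "x \<in> D" "y \<in> D" and l: "joined_within l x y"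
  shows "quasihyperbolic_dist D x y \<le> 2 * (1 + 2 * c) * ln (1 + c * l / min (bdist D x) (bdist D y))"
proof -
  let ?m = "min (bdist D x) (bdist D y)"
  obtain g where g: "g \<in> rect_paths D x y"
    and cig: "\<And>t. t \<in> {0..1} \<Longrightarrow> min (path_length (subpath 0 t g)) (path_length (subpath t 1 g)) \<le> c * bdist D (g t)"
    and len: "path_length g \<le> c * inner_length_dist D x y"
    using U xy rect_arcs_subset unfolding inner_uniform_def by blast
  note rect = rect_pathsD(1)[OF g]
  let ?L = "path_length g" and ?h = "arclength_param g"
  have L0: "0 \<le> ?L" using path_length_nonneg rect by blast
  have pos: "0 < bdist D x" "0 < bdist D y" using xy bdist_pos by auto
  have ends: "?h 0 = x" "?h ?L = y"
    using arclength_param_0[OF rect] arclength_param_end[OF rect] rect_pathsD(4,5)[OF g] by auto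
  let ?f = "\<lambda>u. (1 + 2 * c) * (1 / (bdist D x + u)) + (1 + 2 * c) * (1 / (bdist D y + (?L - u)))"
  have I: "(?f has_integral ((1 + 2 * c) * ln (1 + ?L / bdist D x) + (1 + 2 * c) * ln (1 + ?L / bdist D y))) {0..?L}"
    by (intro has_integral_add has_integral_mult_right has_integral_inverse_affine pos L0)
  have "arclength_integral (\<lambda>z. 1 / bdist D z) g \<le> integral {0..?L} ?f"
    unfolding arclength_integral_def
  proof (rule integral_le)
    show "(\<lambda>u. 1 / bdist D (?h u)) integrable_on {0..?L}" by (rule integrable_inverse_bdist[OF g]) auto
    show "?f integrable_on {0..?L}" using I by blast
    fix u assume u: "u \<in> {0..?L}"
    let ?d = "bdist D (?h u)"
    have d: "0 < ?d" using bdist_pos arclength_param_in[OF g] u by simp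
    have inv: "1 / ?d \<le> (1 + 2 * c) * (1 / b)" if "b \<le> (1 + 2 * c) * ?d" "0 < b" for b
      using that d by (simp add: field_simps)
    have nn: "0 \<le> (1 + 2 * c) * (1 / (bdist D x + u))" "0 \<le> (1 + 2 * c) * (1 / (bdist D y + (?L - u)))"
      using c pos u by (auto intro!: mult_nonneg_nonneg)
    have lip: "bdist D x \<le> ?d + u" "bdist D y \<le> ?d + (?L - u)"
      using bdist_lipschitz[of D x "?h u"] bdist_lipschitz[of D "?h u" y] ends u
        dist_arclength_param[OF rect, of 0 u] dist_arclength_param[OF rect, of u ?L] by auto
    obtain t where t: "t \<in> {0..1}" "vlen g 0 t = u" "?h u = g t" using arclength_param[OF rect, of u] u by auto
    have "path_length (subpath 0 t g) = u" "path_length (subpath t 1 g) = ?L - u"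
      using t vlen_additive[OF rect, of 0 t 1] by (auto simp: path_length_subpath path_length_eq[of g])
    then have "min u (?L - u) \<le> c * ?d" using cig[OF t(1)] t(3) by simp
    then consider "u \<le> c * ?d" | "?L - u \<le> c * ?d" by (auto simp: min_def split: if_splits)
    then show "1 / ?d \<le> ?f u"
    proof cases
      case 1
      then have "bdist D x + u \<le> (1 + 2 * c) * ?d" using lip(1) by (simp add: algebra_simps)
      then show ?thesis using inv[of "bdist D x + u"] nn pos u by simp
    next
      case 2
      then have "bdist D y + (?L - u) \<le> (1 + 2 * c) * ?d" using lip(2) by (simp add: algebra_simps)
      then show ?thesis using inv[of "bdist D y + (?L - u)"] nn pos u by simp
    qed
  qed
  also have "\<dots> = (1 + 2 * c) * (ln (1 + ?L / bdist D x) + ln (1 + ?L / bdist D y))"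
    using integral_unique[OF I] by (simp add: algebra_simps)
  also have "\<dots> \<le> (1 + 2 * c) * (ln (1 + c * l / ?m) + ln (1 + c * l / ?m))"
  proof -
    have "?L \<le> c * l" using len mult_left_mono[OF inner_length_dist_le[OF l] c] by simp
    then have "?L / b \<le> c * l / ?m" if "?m \<le> b" for b
      using that pos L0 by (intro frac_le) auto
    then have "ln (1 + ?L / b) \<le> ln (1 + c * l / ?m)" if "?m \<le> b" for b
      using that L0 pos by (intro ln_mono) (auto intro!: add_pos_nonneg)
    then show ?thesis using c by (intro mult_left_mono add_mono) auto
  qed
  finally show ?thesis using quasihyperbolic_dist_le[OF g] by (simp add: algebra_simps)
qed

section \<open>Bounding k_D by a multiple of j'_D\<close>

lemma rect_arcs_nonempty: "x \<in> D \<Longrightarrow> y \<in> D \<Longrightarrow> rect_arcs D x y \<noteq> {}"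
  using rect_paths_nonempty arc_along_path by (metis all_not_in_conv)

lemma diameter_path_image_nonneg: "g \<in> rect_arcs D x y \<Longrightarrow> 0 \<le> diameter (path_image g)"
  by (auto simp: rect_arcs_def rect_paths_def rectifiable_def
      intro!: diameter_ge_0 compact_imp_bounded compact_path_image)

lemma dist_le_inner_diam_dist:
  assumes "x \<in> D" "y \<in> D" shows "dist x y \<le> inner_diam_dist D x y"
  unfolding inner_diam_dist_def
proof (rule cINF_greatest[OF rect_arcs_nonempty[OF assms]])
  fix g assume "g \<in> rect_arcs D x y"
  then have "g \<in> rect_paths D x y" using rect_arcs_subset by blast
  note gD = rect_pathsD[OF this]
  show "dist x y \<le> diameter (path_image g)"
    using diameter_bounded_bound[OF compact_imp_bounded[OF compact_path_image[OF gD(2)]]]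
      pathstart_in_path_image[of g] pathfinish_in_path_image[of g] gD(4,5) by auto
qed

lemma quasihyperbolic_dist_refl_le: "x \<in> D \<Longrightarrow> quasihyperbolic_dist D x x \<le> 0"
proof -
  assume "x \<in> D"
  note c = rect_arcs_const[OF this]
  then have "(\<lambda>_. x) \<in> rect_paths D x x" using rect_arcs_subset by blast
  note p = this
  have "path_length (\<lambda>_. x) = 0" using path_length_nonneg[OF rect_pathsD(1)[OF p]] c by simp
  then show ?thesis using quasihyperbolic_dist_le[OF p] by (simp add: arclength_integral_def)
qed

text \<open>An arc of diameter below twice rho_D exists only when rho_D is positive, so equal
  endpoints are treated apart. The factors inside the ceiling come from the length of the inner
  uniform arc, the covering argument and this doubling.\<close>

lemma quasihyperbolic_dist_le_j':
  assumes U: "inner_uniform c D" and c: "1 \<le> c" and Q: "finite (Q :: 'a set)" "cball 0 2 \<subseteq> (\<Union>q\<in>Q. ball q (1 / (2 * c)))"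
    and xy: "x \<in> D" "y \<in> D"
  shows "quasihyperbolic_dist D x y \<le>
    2 * (1 + 2 * c) * real (nat \<lceil>c * (4 + 4 * real (card (Q \<times> Q))) * 2\<rceil>) * j'_dist D x y"
proof (cases "x = y")
  case True
  have "0 \<le> j'_dist D x y"
    unfolding j'_dist_def using order_trans[OF zero_le_dist dist_le_inner_diam_dist[OF xy]] xy bdist_pos
    by (intro ln_ge_zero) (auto intro!: divide_nonneg_nonneg bdist_nonneg)
  then have "0 \<le> 2 * (1 + 2 * c) * real (nat \<lceil>c * (4 + 4 * real (card (Q \<times> Q))) * 2\<rceil>) * j'_dist D x y"
    using c by (intro mult_nonneg_nonneg of_nat_0_le_iff) auto
  then show ?thesis using True quasihyperbolic_dist_refl_le[OF xy(1)] by simp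
next
  case False
  let ?M = "4 + 4 * real (card (Q \<times> Q))" and ?m = "min (bdist D x) (bdist D y)"
  define r where "r = inner_diam_dist D x y"
  have r: "0 < r" using less_le_trans[OF _ dist_le_inner_diam_dist[OF xy], of 0] False by (simp add: r_def)
  have m: "0 < ?m" using xy bdist_pos by simp
  have "inner_diam_dist D x y < 2 * r" using r by (simp add: r_def)
  then obtain g where g: "g \<in> rect_arcs D x y" "diameter (path_image g) < 2 * r"
    unfolding inner_diam_dist_def
    by (subst (asm) cINF_less_iff[OF rect_arcs_nonempty[OF xy]])
      (auto intro!: bdd_belowI2[of _ 0] diameter_path_image_nonneg)
  have "joined_within (?M * (2 * r)) x y"
    using joined_within_diameter[OF U c Q, of g x y "2 * r"] g rect_arcs_subset r by auto
  then have "quasihyperbolic_dist D x y \<le> 2 * (1 + 2 * c) * ln (1 + c * (?M * (2 * r)) / ?m)"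
    using quasihyperbolic_dist_le_of_inner_uniform[OF U _ xy] c by simp
  also have "\<dots> = 2 * (1 + 2 * c) * ln (1 + (c * ?M * 2) * (r / ?m))"
  proof -
    have "c * (M * (2 * r)) / m = (c * M * 2) * (r / m)" for M m :: real by simp
    then show ?thesis by (simp only:)
  qed
  also have "\<dots> \<le> 2 * (1 + 2 * c) * (real (nat \<lceil>c * ?M * 2\<rceil>) * ln (1 + r / ?m))"
    using r m c by (intro mult_left_mono ln_scale_le) auto
  finally show ?thesis by (simp add: j'_dist_def r_def mult.assoc)
qed

end

section \<open>The equivalence, with all constants chosen before the domain\<close>

theorem corollary1:
  assumes "CARD('n::finite) \<ge> 2"
  shows "(\<forall>K. \<exists>c \<mu>\<^sub>5. \<forall>D :: (real ^ 'n) set.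
            proper_subdomain D \<longrightarrow> apollonian D \<longrightarrow>
            A_uniform K D \<longrightarrow>
            inner_uniform c D \<and>
            (\<forall>x\<in>D. \<forall>y\<in>D. j'_dist D x y \<le> \<mu>\<^sub>5 * apollonian_dist D x y))
       \<and> (\<forall>c \<mu>\<^sub>5. \<exists>K. \<forall>D :: (real ^ 'n) set.
            proper_subdomain D \<longrightarrow> apollonian D \<longrightarrow>
            inner_uniform c D \<and>
            (\<forall>x\<in>D. \<forall>y\<in>D. j'_dist D x y \<le> \<mu>\<^sub>5 * apollonian_dist D x y) \<longrightarrow>
            A_uniform K D)"
proof (intro conjI allI)
  fix K :: real
  let ?c = "2 * quasi_geodesic_chain.K1 (4 * \<bar>K\<bar>) + quasi_geodesic_chain.K2 (4 * \<bar>K\<bar>) + 1"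
  \<comment> \<open>Since j'_D <= k_D, the coefficient \<open>K\<close> itself serves as the second
    constant.\<close>
  have "inner_uniform ?c D \<and> (\<forall>x\<in>D. \<forall>y\<in>D. j'_dist D x y \<le> K * apollonian_dist D x y)"
    if "proper_subdomain D" "A_uniform K D" for D :: "(real ^ 'n) set"
  proof -
    interpret domain D by (rule domain.intro[OF that(1)])
    have "j'_dist D x y \<le> K * apollonian_dist D x y" if "x \<in> D" "y \<in> D" for x y
      using j'_dist_le_quasihyperbolic_dist[OF that] \<open>A_uniform K D\<close> that
      unfolding A_uniform_def by (meson order_trans)
    then show ?thesis using A_uniform_imp_inner_uniform[OF that(2)] by blast
  qed
  then show "\<exists>c \<mu>\<^sub>5. \<forall>D :: (real ^ 'n) set. proper_subdomain D \<longrightarrow> apollonian D \<longrightarrow> A_uniform K D \<longrightarrow>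
      inner_uniform c D \<and> (\<forall>x\<in>D. \<forall>y\<in>D. j'_dist D x y \<le> \<mu>\<^sub>5 * apollonian_dist D x y)"
    by (intro exI[of _ ?c] exI[of _ K]) simp
next
  fix c \<mu> :: real
  \<comment> \<open>The given \<open>c\<close> is an arbitrary real; raising it to at least 1
    weakens inner uniformity and makes the radii 1/(2c') positive.\<close>
  define c' where "c' = max c 1"
  have c': "c \<le> c'" "1 \<le> c'" by (auto simp: c'_def)
  \<comment> \<open>Total boundedness provides the covering, which depends only on n and
    \<open>c'\<close>; its cardinality carries the dimension into the constant.\<close>
  obtain Q :: "(real ^ 'n) set" where Q: "finite Q" "cball 0 2 \<subseteq> (\<Union>q\<in>Q. ball q (1 / (2 * c')))"
  proof -
    have tb: "\<forall>e>0. \<exists>k. finite k \<and> cball (0 :: real ^ 'n) 2 \<subseteq> (\<Union>q\<in>k. ball q e)"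
      using compact_cball compact_eq_totally_bounded by blast
    have "0 < 1 / (2 * c')" using c' by simp
    from tb[rule_format, OF this] show ?thesis using that by blast
  qed
  define K where "K = 2 * (1 + 2 * c') * real (nat \<lceil>c' * (4 + 4 * real (card (Q \<times> Q))) * 2\<rceil>)"
  have "A_uniform (K * \<mu>) D"
    if D: "proper_subdomain D" and U: "inner_uniform c D"
      and j: "\<forall>x\<in>D. \<forall>y\<in>D. j'_dist D x y \<le> \<mu> * apollonian_dist D x y" for D :: "(real ^ 'n) set"
    unfolding A_uniform_def
  proof (intro ballI)
    interpret domain D by (rule domain.intro[OF D])
    fix x y assume xy: "x \<in> D" "y \<in> D"
    have "quasihyperbolic_dist D x y \<le> K * j'_dist D x y"
      unfolding K_def by (rule quasihyperbolic_dist_le_j'[OF inner_uniform_mono[OF U c'(1)] c'(2) Q xy])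
    also have "\<dots> \<le> K * (\<mu> * apollonian_dist D x y)"
      \<comment> \<open>Only the sign of \<open>K\<close> matters here; \<open>\<mu>\<close> may be
        any real.\<close>
      using j xy c' unfolding K_def by (intro mult_left_mono mult_nonneg_nonneg of_nat_0_le_iff) auto
    finally show "quasihyperbolic_dist D x y \<le> K * \<mu> * apollonian_dist D x y" by (simp add: mult.assoc)
  qed
  then show "\<exists>K. \<forall>D :: (real ^ 'n) set. proper_subdomain D \<longrightarrow> apollonian D \<longrightarrow>
      inner_uniform c D \<and> (\<forall>x\<in>D. \<forall>y\<in>D. j'_dist D x y \<le> \<mu> * apollonian_dist D x y) \<longrightarrow> A_uniform K D"
    by (intro exI[of _ "K * \<mu>"]) simp
qed

end
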